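(* Let $A\in M_n$, $B\in M_m$, $c\in\mathbb{R}^n$, $d\in\mathbb{R}^m$ with $W(A;c)$ and $W(B;d)$ nonempty. Suppose $W(A;c)$ and $W(B;d)$ have more than $\deg(A;c)\deg(B;d)$ pairwise distinct common supporting lines, and that: (1) either $W(A;c)=W_c(A)$, or $W(A;c)$ has nonempty interior and each of these common supporting lines touches $\partial W(A;c)$ at a point where $\partial W(A;c)$ is differentiable; (2) either $W(B;d)=W_d(B)$, or $W(B;d)$ has nonempty interior and each of these common supporting lines touches $\partial W(B;d)$ at a point where $\partial W(B;d)$ is differentiable. Then there exists a $c$-value of $A$ which is also a $d$-value of $B$. Furthermore, if $r(A;c)$ is irreducible in $\mathbb{C}[x,y,t]$, then every $c$-value of $A$ is a $d$-value of $B$.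
   Context: $M_n$ denotes the space of $n\times n$ complex matrices. For $A\in M_n$ and $\theta\in\mathbb{R}$, $H_\theta(A)=\frac{1}{2}(e^{i\theta}A+e^{-i\theta}A^* )$; for a Hermitian $H$, $\lambda_1(H)\ge\cdots\ge\lambda_n(H)$ are its eigenvalues in nonincreasing order with multiplicity. For $c\in\mathbb{R}^n$ the weighted numerical range is $W(A;c)=\bigcap_{\theta\in[0,2\pi)}\{v\in\mathbb{C}:\mathrm{Re}(e^{i\theta}v)\le\sum_{j=1}^n c_j\lambda_j(H_\theta(A))\}$, and the $c$-numerical range is $W_c(A)=\{\sum_{j=1}^n c_jx_j^*Ax_j:\ x_1,\dots,x_n\in\mathbb{C}^n\text{ orthonormal}\}$. A common supporting line of two nonempty sets $K_1,K_2\subseteq\mathbb{C}$ is a line $L$ meeting both sets such that $K_1$ and $K_2$ lie in the same closed half-plane bounded by $L$. For a general $M\in M_n$ let $\lambda_1(M),\dots,\lambda_n(M)$ be its eigenvalues with algebraic multiplicity. Let $i_1<\dots<i_r$ be the indices with $c_{i_s}\ne0$. A $c$-value of $M$ is $\sum_{s=1}^r c_{i_s}\lambda_{j_s}(M)$ with $j_1,\dots,j_r$ pairwise distinct. Call index tuples formally equivalent if the linear forms $\sum_s c_{i_s}X_{j_s}$, $\sum_s c_{i_s}X_{j'_s}$ in indeterminates coincide; with $\mathcal{F}$ a set of class representatives, $p(M;c)(t)=\prod_{(j_s)\in\mathcal{F}}(t-\sum_s c_{i_s}\lambda_{j_s}(M))$ and $\deg(M;c)=|\mathcal{F}|$. Set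 $r(A;c)(x,y,t)=p(xA+yA^*;c)(t)$, a homogeneous polynomial of degree $\deg(A;c)$. Analogous definitions for $B\in M_m$, $d\in\mathbb{R}^m$. *)

theory Defs
  imports "HOL-Analysis.Analysis"
    "HOL-Computational_Algebra.Fundamental_Theorem_Algebra"
    "Jordan_Normal_Form.Schur_Decomposition"
    "Jordan_Normal_Form.Char_Poly"
begin

text \<open>Matrices are Jordan_Normal_Form matrices of type complex mat; an n x n matrix is
  one in carrier_mat n n. Weight vectors c in R^n are functions c :: nat => real, only the
  values c 0, ..., c (n-1) being relevant (0-based indexing of c_1, ..., c_n).\<close>

definition H_theta :: "real \<Rightarrow> complex mat \<Rightarrow> complex mat" where
  "H_theta \<theta> A = (1/2 :: complex) \<cdot>\<^sub>m (exp (\<i> * of_real \<theta>) \<cdot>\<^sub>m A + exp (- \<i> * of_real \<theta>) \<cdot>\<^sub>m mat_adjoint A)"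

definition eig_mset :: "complex mat \<Rightarrow> complex multiset" where
  "eig_mset M = proots (char_poly M)"

text \<open>Eigenvalues of a Hermitian matrix in nonincreasing order: herm_eig H ! j is
  lambda_{j+1}(H).\<close>
definition herm_eig :: "complex mat \<Rightarrow> real list" where
  "herm_eig H = rev (sorted_list_of_multiset (image_mset Re (eig_mset H)))"

definition W_weighted :: "nat \<Rightarrow> complex mat \<Rightarrow> (nat \<Rightarrow> real) \<Rightarrow> complex set" where
  "W_weighted n A c = (\<Inter>\<theta>\<in>{0..<2*pi}.
     {v. Re (exp (\<i> * of_real \<theta>) * v) \<le> (\<Sum>j<n. c j * herm_eig (H_theta \<theta> A) ! j)})"

definition W_c :: "nat \<Rightarrow> complex mat \<Rightarrow> (nat \<Rightarrow> real) \<Rightarrow> complex set" where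
  "W_c n A c = {(\<Sum>j<n. of_real (c j) * (conjugate (x j) \<bullet> (A *\<^sub>v x j))) | x.
     (\<forall>j<n. x j \<in> carrier_vec n) \<and>
     (\<forall>j<n. \<forall>k<n. conjugate (x j) \<bullet> x k = (if j = k then 1 else 0))}"

definition is_line :: "complex set \<Rightarrow> bool" where
  "is_line L \<longleftrightarrow> (\<exists>u a. u \<noteq> 0 \<and> L = {z. Re (cnj u * z) = a})"

definition common_supporting_line :: "complex set \<Rightarrow> complex set \<Rightarrow> complex set \<Rightarrow> bool" where
  "common_supporting_line K1 K2 L \<longleftrightarrow>
     L \<inter> K1 \<noteq> {} \<and> L \<inter> K2 \<noteq> {} \<and>
     (\<exists>u a. u \<noteq> 0 \<and> L = {z. Re (cnj u * z) = a} \<and>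
        K1 \<subseteq> {z. Re (cnj u * z) \<le> a} \<and> K2 \<subseteq> {z. Re (cnj u * z) \<le> a})"

definition boundary_differentiable_at :: "complex set \<Rightarrow> complex \<Rightarrow> bool" where
  "boundary_differentiable_at S z \<longleftrightarrow> z \<in> frontier S \<and>
     (\<exists>u f e. cmod u = 1 \<and> e > 0 \<and> f 0 = (0::real) \<and> f differentiable (at 0) \<and>
        frontier S \<inter> ball z e = range (\<lambda>s. z + u * Complex s (f s)) \<inter> ball z e)"

definition eig_list :: "complex mat \<Rightarrow> complex list" where
  "eig_list M = (SOME xs. mset xs = eig_mset M)"

text \<open>Index tuples: an injective assignment sigma of eigenvalue indices j_s = sigma i_s
  to the indices i with c_i \<noteq> 0. Its linear form sum_s c_{i_s} X_{j_s} is represented by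
  its coefficient function k \<mapsto> coefficient of X_k.\<close>
definition supp_c :: "nat \<Rightarrow> (nat \<Rightarrow> real) \<Rightarrow> nat set" where
  "supp_c n c = {i. i < n \<and> c i \<noteq> 0}"

definition index_tuple :: "nat \<Rightarrow> (nat \<Rightarrow> real) \<Rightarrow> (nat \<Rightarrow> nat) \<Rightarrow> bool" where
  "index_tuple n c \<sigma> \<longleftrightarrow> inj_on \<sigma> (supp_c n c) \<and> \<sigma> ` supp_c n c \<subseteq> {..<n}"

definition lin_form :: "nat \<Rightarrow> (nat \<Rightarrow> real) \<Rightarrow> (nat \<Rightarrow> nat) \<Rightarrow> nat \<Rightarrow> real" where
  "lin_form n c \<sigma> k = (\<Sum>i\<in>{i\<in>supp_c n c. \<sigma> i = k}. c i)"

text \<open>The set of linear forms = the set of formal equivalence classes of index tuples.\<close>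
definition forms :: "nat \<Rightarrow> (nat \<Rightarrow> real) \<Rightarrow> (nat \<Rightarrow> real) set" where
  "forms n c = {lin_form n c \<sigma> | \<sigma>. index_tuple n c \<sigma>}"

definition c_value :: "nat \<Rightarrow> complex mat \<Rightarrow> (nat \<Rightarrow> real) \<Rightarrow> complex \<Rightarrow> bool" where
  "c_value n M c v \<longleftrightarrow> (\<exists>\<sigma>. index_tuple n c \<sigma> \<and>
     v = (\<Sum>s\<in>supp_c n c. of_real (c s) * eig_list M ! \<sigma> s))"

definition p_poly :: "nat \<Rightarrow> complex mat \<Rightarrow> (nat \<Rightarrow> real) \<Rightarrow> complex poly" where
  "p_poly n M c = (\<Prod>f\<in>forms n c. [:- (\<Sum>k<n. of_real (f k) * eig_list M ! k), 1:])"

definition deg_c :: "nat \<Rightarrow> (nat \<Rightarrow> real) \<Rightarrow> nat" where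
  "deg_c n c = card (forms n c)"

text \<open>C[x,y,t] is represented as ((C[x])[y])[t] = complex poly poly poly.\<close>
definition eval3 :: "complex poly poly poly \<Rightarrow> complex \<Rightarrow> complex \<Rightarrow> complex \<Rightarrow> complex" where
  "eval3 q x y t = poly (poly (poly q [:[:t:]:]) [:y:]) x"

definition r_poly :: "nat \<Rightarrow> complex mat \<Rightarrow> (nat \<Rightarrow> real) \<Rightarrow> complex poly poly poly" where
  "r_poly n A c = (THE q. \<forall>x y t. eval3 q x y t =
      poly (p_poly n (x \<cdot>\<^sub>m A + y \<cdot>\<^sub>m mat_adjoint A) c) t)"

end

theory Submission
  imports Defs "Subresultants.Resultant_Prelim" "HOL-Computational_Algebra.Field_as_Ring"
    "HOL-Computational_Algebra.Polynomial_Factorial"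
begin

text \<open>A common supporting line \<open>Re (e\<^sup>i\<^sup>\<theta> z) = a\<close> gives a common zero
  \<open>(e\<^sup>i\<^sup>\<theta> : e\<^sup>-\<^sup>i\<^sup>\<theta> : 2a)\<close> of the homogeneous polynomials
  \<open>r(A;c)\<close> and \<open>r(B;d)\<close>. If the weighted range is the \<open>c\<close>-numerical range, then \<open>a\<close> is attained at
  eigenvectors of \<open>H\<^sub>\<theta>\<close>; otherwise a limit of nearly supporting directions gives some supporting
  line at the point of contact with this property, and differentiability makes the supporting line
  unique. Distinct lines give distinct zeros, all with \<open>y \<noteq> 0\<close>, so by Bezout's theorem the
  resultant with respect to \<open>t\<close> vanishes identically. At \<open>(x, y) = (1, 0)\<close> this is a common value,
  and if \<open>r(A;c)\<close> is irreducible, hence prime, it must divide \<open>r(B;d)\<close>.\<close>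

section \<open>Polynomial functions and symmetric functions\<close>

text \<open>The eigenvalues of x A + y A* are not polynomial in (x, y), and \<open>r_poly\<close> is
  a definite description, so it must be shown that the coefficients of \<open>p_poly\<close> along
  this pencil are polynomial. Since \<open>p_poly\<close> has one factor for each linear form and
  not for each index tuple, the power sums of its roots are obtained by summing over injections and
  dividing by the number of injections behind one form. Continuity, homogeneity and specialization
  of \<open>r_poly\<close> rest on its description by values.

  The other obstacle is the count in Bezout's theorem. In the chart y = 1 a line with angle theta
  has x-coordinate cis (2 theta), so parallel supporting lines, which may lie on opposite sides of
  the two ranges, share this coordinate. One root x of the resultant must therefore account for
  several points, and its multiplicity has to be bounded below by the number of common roots t above
  it.\<close>

definition eval2 :: "complex \<Rightarrow> complex \<Rightarrow> complex poly poly \<Rightarrow> complex" where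
  "eval2 x y p = poly (poly p [:y:]) x"

interpretation eval2: comm_ring_hom "eval2 x y" for x y
  by unfold_locales (auto simp: eval2_def)

text \<open>A predicate on functions, because it is applied to symmetric expressions in the
  eigenvalues: these are polynomial in x and y although the eigenvalues themselves are not.\<close>

definition polynomial_fun2 :: "(complex \<Rightarrow> complex \<Rightarrow> complex) \<Rightarrow> bool" where
  "polynomial_fun2 F \<longleftrightarrow> (\<exists>q. \<forall>x y. F x y = eval2 x y q)"

lemma polynomial_fun2_const [intro]: "polynomial_fun2 (\<lambda>x y. a)"
  unfolding polynomial_fun2_def by (rule exI[of _ "[:[:a:]:]"]) (simp add: eval2_def)

lemma polynomial_fun2_add [intro]:
  assumes "polynomial_fun2 F" "polynomial_fun2 G"
  shows "polynomial_fun2 (\<lambda>x y. F x y + G x y)"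
  using assms unfolding polynomial_fun2_def by (metis eval2.hom_add)

lemma polynomial_fun2_mult [intro]:
  assumes "polynomial_fun2 F" "polynomial_fun2 G"
  shows "polynomial_fun2 (\<lambda>x y. F x y * G x y)"
  using assms unfolding polynomial_fun2_def by (metis eval2.hom_mult)

lemma polynomial_fun2_diff [intro]:
  assumes "polynomial_fun2 F" "polynomial_fun2 G"
  shows "polynomial_fun2 (\<lambda>x y. F x y - G x y)"
  using assms unfolding polynomial_fun2_def by (metis eval2.hom_minus)

lemma polynomial_fun2_sum [intro]:
  assumes "\<And>i. i \<in> I \<Longrightarrow> polynomial_fun2 (F i)"
  shows "polynomial_fun2 (\<lambda>x y. \<Sum>i\<in>I. F i x y)"
  using assms by (induction I rule: infinite_finite_induct) auto

section \<open>Newton's identities: from coefficients to power sums and back\<close>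

lemma coeff_linear_mult:
  fixes q :: "'a :: comm_ring_1 poly"
  shows "coeff ([:- a, 1:] * q) l = (if l = 0 then 0 else coeff q (l - 1)) - a * coeff q l"
  by (simp add: coeff_pCons split: nat.splits)

text \<open>Synthetic division from the top: the coefficients of the product are differences of
  neighbouring terms, so the sum telescopes, and the degree bound removes the term left over at the
  upper end.\<close>

lemma coeff_quotient_linear:
  fixes q :: "'a :: comm_ring_1 poly"
  assumes "degree q < N"
  shows "coeff q j = (\<Sum>l\<in>{j<..N}. coeff ([:- a, 1:] * q) l * a ^ (l - Suc j))"
proof -
  define p where "p = [:- a, 1:] * q"
  have "(\<Sum>l\<in>{j<..j+m}. coeff p l * a ^ (l - Suc j)) = coeff q j - a ^ m * coeff q (j + m)" for m
  proof (induction m)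
    case (Suc m)
    have *: "{j<..j + Suc m} = insert (j + Suc m) {j<..j+m}" by auto
    have "coeff p (Suc (j + m)) = coeff q (j + m) - a * coeff q (Suc (j + m))"
      unfolding p_def coeff_linear_mult by simp
    thus ?case unfolding * by (simp add: Suc ring_distribs mult_ac)
  qed auto
  from this[of "N - j"] show ?thesis
    unfolding p_def[symmetric] using assms by (cases "j \<le> N") (auto simp: coeff_eq_0)
qed

text \<open>Newton's identities, read off from \<open>X p' = \<Sum>\<^sub>i X p / (X - \<mu>\<^sub>i)\<close>.\<close>
lemma newton_identity:
  fixes \<mu> :: "'b \<Rightarrow> 'a :: idom"
  assumes "finite I" and j: "j \<le> card I"
  defines "p \<equiv> \<Prod>i\<in>I. [:- \<mu> i, 1:]"
  shows "of_nat j * coeff p j = (\<Sum>l=j..card I. coeff p l * (\<Sum>i\<in>I. \<mu> i ^ (l - j)))"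
proof -
  define q where "q i = (\<Prod>k\<in>I - {i}. [:- \<mu> k, 1:])" for i
  have p: "p = [:- \<mu> i, 1:] * q i" if "i \<in> I" for i
    unfolding p_def q_def using assms(1) that by (simp add: prod.remove)
  have d: "degree (q i) < card I" if "i \<in> I" for i
  proof -
    have "degree (q i) = card (I - {i})"
      unfolding q_def by (subst degree_prod_sum_eq) auto
    thus ?thesis using that assms(1) by (metis card_Diff1_less)
  qed
  have "pderiv p = (\<Sum>i\<in>I. q i * pderiv [:- \<mu> i, 1:])"
    unfolding p_def q_def by (rule pderiv_prod)
  also have "\<dots> = (\<Sum>i\<in>I. q i)" by (simp add: pderiv_pCons)
  finally have "[:0, 1:] * pderiv p = (\<Sum>i\<in>I. p + Polynomial.smult (\<mu> i) (q i))"
    by (simp add: sum_distrib_left p)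
  hence "coeff ([:0, 1:] * pderiv p) j = (\<Sum>i\<in>I. coeff p j + \<mu> i * coeff (q i) j)"
    by (simp only: coeff_sum coeff_add coeff_smult)
  also have "\<dots> = (\<Sum>i\<in>I. \<Sum>l=j..card I. coeff p l * \<mu> i ^ (l - j))"
  proof (rule sum.cong[OF refl])
    fix i assume i: "i \<in> I"
    have *: "{j..card I} = insert j {j<..card I}" using j by auto
    have "\<mu> i * coeff (q i) j = (\<Sum>l\<in>{j<..card I}. coeff p l * \<mu> i ^ (l - j))"
      unfolding coeff_quotient_linear[OF d[OF i], of j "\<mu> i"] p[OF i] sum_distrib_left
      by (rule sum.cong) (auto simp: Suc_diff_Suc simp flip: power_Suc)
    thus "coeff p j + \<mu> i * coeff (q i) j = (\<Sum>l=j..card I. coeff p l * \<mu> i ^ (l - j))"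
      unfolding * by simp
  qed
  also have "\<dots> = (\<Sum>l=j..card I. \<Sum>i\<in>I. coeff p l * \<mu> i ^ (l - j))" by (rule sum.swap)
  finally show ?thesis
    by (cases j) (simp_all add: coeff_pderiv sum_distrib_left coeff_pCons)
qed

lemma monic_prod_linear:
  fixes \<mu> :: "'b \<Rightarrow> 'a :: idom"
  assumes "finite I"
  defines "p \<equiv> \<Prod>i\<in>I. [:- \<mu> i, 1:]"
  shows "degree p = card I" "coeff p (card I) = 1"
proof -
  show d: "degree p = card I" unfolding p_def by (subst degree_prod_sum_eq) auto
  show "coeff p (card I) = 1"
    using d lead_coeff_prod[of "\<lambda>i. [:- \<mu> i, 1:]" I] unfolding p_def by auto
qed

lemma polynomial_fun2_power_sums:
  fixes \<mu> :: "'b \<Rightarrow> complex \<Rightarrow> complex \<Rightarrow> complex"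
  assumes fin: "finite I"
    and coeffs: "\<And>l. polynomial_fun2 (\<lambda>x y. coeff (\<Prod>i\<in>I. [:- \<mu> i x y, 1:]) l)"
  shows "polynomial_fun2 (\<lambda>x y. \<Sum>i\<in>I. \<mu> i x y ^ k)"
proof (induction k rule: less_induct)
  case (less k)
  define p where "p x y = (\<Prod>i\<in>I. [:- \<mu> i x y, 1:])" for x y
  note mon = monic_prod_linear[OF fin, of "\<lambda>i. \<mu> i _ _", folded p_def]
  have co: "polynomial_fun2 (\<lambda>x y. coeff (p x y) l)" for l using coeffs unfolding p_def .
  show ?case
  proof (cases "k < card I")
    case True
    \<comment> \<open>At this index the top term \<open>l = card I\<close> of Newton's identity has
      coefficient 1 and carries the power sum of exponent k; the remaining terms have smaller
      exponents.\<close>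
    define j where "j = card I - k"
    have *: "{j..card I} = insert (card I) {j..<card I}" and jk: "card I - j = k" "j \<le> card I"
      using True by (auto simp: j_def)
    have "(\<Sum>i\<in>I. \<mu> i x y ^ k) = of_nat j * coeff (p x y) j
        - (\<Sum>l\<in>{j..<card I}. coeff (p x y) l * (\<Sum>i\<in>I. \<mu> i x y ^ (l - j)))" for x y
      unfolding newton_identity[OF fin jk(2), of "\<lambda>i. \<mu> i x y", folded p_def] * using mon(2)
      by (simp add: jk)
    moreover have "polynomial_fun2 (\<lambda>x y. \<Sum>i\<in>I. \<mu> i x y ^ (l - j))" if "l \<in> {j..<card I}" for l
      by (rule less.IH) (use that jk in auto)
    ultimately show ?thesis
      by (simp only:) (intro polynomial_fun2_diff polynomial_fun2_mult polynomial_fun2_sum[of "{j..<card I}"] polynomial_fun2_const co; simp)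
  next
    case False
    define m where "m = k - card I"
    \<comment> \<open>From exponent \<open>card I\<close> on, a linear recurrence takes over: each
      \<mu> is a root of p, and p(\<mu>) = 0 is multiplied by \<mu> ^ m and summed.\<close>
    have "(\<Sum>i\<in>I. \<mu> i x y ^ k) = 0 - (\<Sum>l<card I. coeff (p x y) l * (\<Sum>i\<in>I. \<mu> i x y ^ (l + m)))" for x y
    proof -
      have "poly (p x y) (\<mu> i x y) = 0" if "i \<in> I" for i
        unfolding p_def poly_prod using that fin by auto
      hence "0 = (\<Sum>i\<in>I. \<mu> i x y ^ m * poly (p x y) (\<mu> i x y))" by simp
      also have "\<dots> = (\<Sum>i\<in>I. \<Sum>l\<le>card I. coeff (p x y) l * \<mu> i x y ^ (l + m))"
        unfolding poly_altdef mon by (simp add: sum_distrib_left power_add algebra_simps)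
      also have "\<dots> = (\<Sum>l\<le>card I. coeff (p x y) l * (\<Sum>i\<in>I. \<mu> i x y ^ (l + m)))"
        by (subst sum.swap) (simp add: sum_distrib_left)
      also have "{..card I} = insert (card I) {..<card I}" by auto
      finally show ?thesis
        using mon(2) False by (simp add: m_def eq_neg_iff_add_eq_0)
    qed
    moreover have "polynomial_fun2 (\<lambda>x y. \<Sum>i\<in>I. \<mu> i x y ^ (l + m))" if "l \<in> {..<card I}" for l
      by (rule less.IH) (use that False m_def in auto)
    ultimately show ?thesis
      by (simp only:) (intro polynomial_fun2_diff polynomial_fun2_mult polynomial_fun2_sum[of "{..<card I}"] polynomial_fun2_const co; simp)
  qed
qed

lemma polynomial_fun2_coeffs:
  fixes \<mu> :: "'b \<Rightarrow> complex \<Rightarrow> complex \<Rightarrow> complex"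
  assumes fin: "finite I"
    and sums: "\<And>k. polynomial_fun2 (\<lambda>x y. \<Sum>i\<in>I. \<mu> i x y ^ k)"
  shows "polynomial_fun2 (\<lambda>x y. coeff (\<Prod>i\<in>I. [:- \<mu> i x y, 1:]) l)"
proof -
  define p where "p x y = (\<Prod>i\<in>I. [:- \<mu> i x y, 1:])" for x y
  note mon = monic_prod_linear[OF fin, of "\<lambda>i. \<mu> i _ _", folded p_def]
  have *: "polynomial_fun2 (\<lambda>x y. coeff (p x y) (card I - k))" for k
  proof (induction k rule: less_induct)
    case (less k)
    show ?case
    proof (cases "card I - k = card I")
      case True
      thus ?thesis using mon(2) by auto
    next
      case False
      define j where "j = card I - k"
      have j: "j < card I" using False by (auto simp: j_def)
      hence *: "{j..card I} = insert j {j<..card I}" by auto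
      have "of_nat j * coeff (p x y) j - of_nat (card I) * coeff (p x y) j =
         (\<Sum>l\<in>{j<..card I}. coeff (p x y) l * (\<Sum>i\<in>I. \<mu> i x y ^ (l - j)))" for x y
        unfolding newton_identity[OF fin less_imp_le[OF j], of "\<lambda>i. \<mu> i x y", folded p_def] * by simp
      \<comment> \<open>The term l = j carries the zeroth power sum \<open>card I\<close>. Moving it
        to the left leaves this factor, which is invertible in characteristic zero.\<close>
      moreover have "of_nat j - of_nat (card I) \<noteq> (0::complex)"
        using j by simp
      ultimately have "coeff (p x y) j = 1 / (of_nat j - of_nat (card I)) *
         (\<Sum>l\<in>{j<..card I}. coeff (p x y) l * (\<Sum>i\<in>I. \<mu> i x y ^ (l - j)))" for x y
        by (simp add: field_simps)
      moreover have "polynomial_fun2 (\<lambda>x y. coeff (p x y) l)" if l: "l \<in> {j<..card I}" for l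
      proof -
        have "polynomial_fun2 (\<lambda>x y. coeff (p x y) (card I - (card I - l)))"
          by (rule less.IH) (use l j_def in auto)
        thus ?thesis using l by simp
      qed
      ultimately show ?thesis unfolding j_def[symmetric]
        by (simp only:) (intro polynomial_fun2_diff polynomial_fun2_mult polynomial_fun2_sum polynomial_fun2_const sums; simp)
    qed
  qed
  show ?thesis
  proof (cases "l \<le> card I")
    case True
    thus ?thesis using *[of "card I - l"] by (simp add: p_def)
  next
    case False
    hence "coeff (p x y) l = 0" for x y using mon(1) by (auto intro: coeff_eq_0)
    thus ?thesis by (auto simp: p_def)
  qed
qed

text \<open>A value k chosen for the new element a either avoids the image of \<sigma>, which
  extends \<sigma> to an injection on \<open>insert a S\<close>, or equals \<sigma> b for exactly
  one b in S.\<close>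

lemma sum_injections_insert:
  fixes g :: "nat \<Rightarrow> 'a :: comm_semiring_1" and n :: nat and S :: "'b set"
  assumes S: "finite S" "a \<notin> S"
  defines "Inj \<equiv> \<lambda>S. {\<sigma> \<in> S \<rightarrow>\<^sub>E {..<n}. inj_on \<sigma> S}"
  shows "(\<Sum>\<sigma>\<in>Inj S. F \<sigma> * (\<Sum>k<n. g k)) =
    (\<Sum>\<sigma>\<in>Inj (insert a S). F (restrict \<sigma> S) * g (\<sigma> a)) + (\<Sum>b\<in>S. \<Sum>\<sigma>\<in>Inj S. F \<sigma> * g (\<sigma> b))"
proof -
  have fin: "finite (Inj S)" if "finite S" for S :: "'b set"
    unfolding Inj_def by (rule finite_subset[OF _ finite_PiE[OF that, of "\<lambda>_. {..<n}"]]) auto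
  have split: "(\<Sum>k<n. g k) = (\<Sum>k\<in>{..<n} - \<sigma> ` S. g k) + (\<Sum>b\<in>S. g (\<sigma> b))" if "\<sigma> \<in> Inj S" for \<sigma>
  proof -
    have "\<sigma> ` S \<subseteq> {..<n}" "inj_on \<sigma> S" using that by (auto simp: Inj_def)
    thus ?thesis
      by (subst sum.subset_diff[of "\<sigma> ` S"]) (auto simp: sum.reindex)
  qed
  have "(\<Sum>\<sigma>\<in>Inj S. F \<sigma> * (\<Sum>k<n. g k)) =
      (\<Sum>\<sigma>\<in>Inj S. \<Sum>k\<in>{..<n} - \<sigma> ` S. F \<sigma> * g k) + (\<Sum>\<sigma>\<in>Inj S. \<Sum>b\<in>S. F \<sigma> * g (\<sigma> b))"
    by (simp add: split distrib_left sum.distrib sum_distrib_left)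
  also have "(\<Sum>\<sigma>\<in>Inj S. \<Sum>b\<in>S. F \<sigma> * g (\<sigma> b)) = (\<Sum>b\<in>S. \<Sum>\<sigma>\<in>Inj S. F \<sigma> * g (\<sigma> b))"
    by (rule sum.swap)
  also have "(\<Sum>\<sigma>\<in>Inj S. \<Sum>k\<in>{..<n} - \<sigma> ` S. F \<sigma> * g k) =
     (\<Sum>(\<sigma>,k)\<in>(SIGMA \<sigma>:Inj S. {..<n} - \<sigma> ` S). F \<sigma> * g k)"
    by (rule sum.Sigma) (auto intro: fin S)
  also have "\<dots> = (\<Sum>\<sigma>\<in>Inj (insert a S). F (restrict \<sigma> S) * g (\<sigma> a))"
  proof (rule sum.reindex_bij_witness[where i="\<lambda>\<sigma>. (restrict \<sigma> S, \<sigma> a)" and j="\<lambda>(\<sigma>,k). \<sigma>(a := k)"])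
    fix p assume p: "p \<in> (SIGMA \<sigma>:Inj S. {..<n} - \<sigma> ` S)"
    obtain \<sigma> k where pk: "p = (\<sigma>, k)" by force
    have \<sigma>: "\<sigma> \<in> S \<rightarrow>\<^sub>E {..<n}" "inj_on \<sigma> S" "k < n" "k \<notin> \<sigma> ` S" using p pk by (auto simp: Inj_def)
    have r: "restrict (\<sigma>(a := k)) S = \<sigma>" using \<sigma>(1) S(2)
      by (auto simp: fun_eq_iff restrict_def PiE_def extensional_def)
    show "(restrict ((\<lambda>(\<sigma>,k). \<sigma>(a := k)) p) S, (\<lambda>(\<sigma>,k). \<sigma>(a := k)) p a) = p" using r pk by simp
    have "\<sigma>(a := k) \<in> insert a S \<rightarrow>\<^sub>E {..<n}" using \<sigma> by (auto simp: PiE_def extensional_def)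
    moreover have "inj_on (\<sigma>(a := k)) (insert a S)" using \<sigma> S(2)
      by (auto simp: inj_on_def)
    ultimately show "(\<lambda>(\<sigma>,k). \<sigma>(a := k)) p \<in> Inj (insert a S)" using pk by (auto simp: Inj_def)
    show "F (restrict ((\<lambda>(\<sigma>, k). \<sigma>(a := k)) p) S) * g ((\<lambda>(\<sigma>, k). \<sigma>(a := k)) p a) = (case p of (\<sigma>, k) \<Rightarrow> F \<sigma> * g k)"
      using pk r by simp
  next
    fix \<sigma> assume \<sigma>: "\<sigma> \<in> Inj (insert a S)"
    show "(\<lambda>(\<sigma>, k). \<sigma>(a := k)) (restrict \<sigma> S, \<sigma> a) = \<sigma>" using \<sigma>
      by (auto simp: Inj_def PiE_def extensional_def restrict_def fun_eq_iff)
    show "(restrict \<sigma> S, \<sigma> a) \<in> (SIGMA \<sigma>:Inj S. {..<n} - \<sigma> ` S)" using \<sigma> S(2)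
      by (auto simp: Inj_def inj_on_def)
  qed
  finally show ?thesis .
qed

text \<open>Monomial symmetric functions, up to a factor, reduced to power sums. Subtracting the
  collisions \<sigma> a = \<sigma> b merges the exponents of a and b, which is why e is arbitrary in
  the induction.\<close>

lemma polynomial_fun2_monomial_sum:
  fixes \<alpha> :: "nat \<Rightarrow> complex \<Rightarrow> complex \<Rightarrow> complex"
  assumes "finite S"
    and sums: "\<And>k. polynomial_fun2 (\<lambda>x y. \<Sum>i<n. \<alpha> i x y ^ k)"
  shows "polynomial_fun2 (\<lambda>x y. \<Sum>\<sigma>\<in>{\<sigma> \<in> S \<rightarrow>\<^sub>E {..<n}. inj_on \<sigma> S}. \<Prod>s\<in>S. \<alpha> (\<sigma> s) x y ^ e s)"
  using assms(1)
proof (induction S arbitrary: e)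
  case empty
  thus ?case by auto
next
  case (insert a S)
  let ?Inj = "\<lambda>S. {\<sigma> \<in> S \<rightarrow>\<^sub>E {..<n}. inj_on \<sigma> S}"
  have prod: "(\<Prod>s\<in>insert a S. \<alpha> (\<sigma> s) x y ^ e s) =
     (\<Prod>s\<in>S. \<alpha> (restrict \<sigma> S s) x y ^ e s) * \<alpha> (\<sigma> a) x y ^ e a" for \<sigma> x y
    using insert by (simp add: mult.commute)
  have upd: "(\<Prod>s\<in>S. \<alpha> (\<sigma> s) x y ^ e s) * \<alpha> (\<sigma> b) x y ^ e a = (\<Prod>s\<in>S. \<alpha> (\<sigma> s) x y ^ (e(b := e b + e a)) s)"
    if "b \<in> S" for \<sigma> x y b
    using that insert(1) by (auto simp: prod.remove[of S b] power_add mult_ac intro!: prod.cong)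
  have "(\<Sum>\<sigma>\<in>?Inj (insert a S). \<Prod>s\<in>insert a S. \<alpha> (\<sigma> s) x y ^ e s) =
     (\<Sum>\<sigma>\<in>?Inj S. \<Prod>s\<in>S. \<alpha> (\<sigma> s) x y ^ e s) * (\<Sum>i<n. \<alpha> i x y ^ e a) -
     (\<Sum>b\<in>S. \<Sum>\<sigma>\<in>?Inj S. \<Prod>s\<in>S. \<alpha> (\<sigma> s) x y ^ (e(b := e b + e a)) s)" for x y
    unfolding prod sum_distrib_right 
    using sum_injections_insert[OF insert(1,2), where n=n and g="\<lambda>k. \<alpha> k x y ^ e a" and F="\<lambda>\<sigma>. \<Prod>s\<in>S. \<alpha> (\<sigma> s) x y ^ e s"]
    by (simp add: upd cong: sum.cong del: fun_upd_apply)
  thus ?case by (simp only:) (intro polynomial_fun2_diff polynomial_fun2_mult polynomial_fun2_sum polynomial_fun2_const insert.IH sums)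
qed

text \<open>The induction on q carries an additional monomial with exponents e. Expanding one factor
  of the power raises one exponent by 1, and e = 0 is the claim.\<close>

lemma polynomial_fun2_linear_form_power_sum:
  fixes \<alpha> :: "nat \<Rightarrow> complex \<Rightarrow> complex \<Rightarrow> complex" and c :: "'b \<Rightarrow> complex"
  assumes "finite S"
    and sums: "\<And>k. polynomial_fun2 (\<lambda>x y. \<Sum>i<n. \<alpha> i x y ^ k)"
  shows "polynomial_fun2 (\<lambda>x y. \<Sum>\<sigma>\<in>{\<sigma> \<in> S \<rightarrow>\<^sub>E {..<n}. inj_on \<sigma> S}. (\<Sum>s\<in>S. c s * \<alpha> (\<sigma> s) x y) ^ q)"
proof -
  let ?Inj = "{\<sigma> \<in> S \<rightarrow>\<^sub>E {..<n}. inj_on \<sigma> S}"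
  have "polynomial_fun2 (\<lambda>x y. \<Sum>\<sigma>\<in>?Inj. (\<Sum>s\<in>S. c s * \<alpha> (\<sigma> s) x y) ^ q * (\<Prod>s\<in>S. \<alpha> (\<sigma> s) x y ^ e s))" for e
  proof (induction q arbitrary: e)
    case 0
    thus ?case using polynomial_fun2_monomial_sum[OF assms] by simp
  next
    case (Suc q)
    have upd: "(\<Prod>s\<in>S. \<alpha> (\<sigma> s) x y ^ e s) * \<alpha> (\<sigma> b) x y = (\<Prod>s\<in>S. \<alpha> (\<sigma> s) x y ^ (e(b := Suc (e b))) s)"
      if "b \<in> S" for \<sigma> x y b
      using that assms(1) by (auto simp: prod.remove[of S b] mult_ac intro!: prod.cong)
    have *: "(\<Sum>\<sigma>\<in>?Inj. (\<Sum>s\<in>S. c s * \<alpha> (\<sigma> s) x y) ^ Suc q * (\<Prod>s\<in>S. \<alpha> (\<sigma> s) x y ^ e s)) =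
      (\<Sum>\<sigma>\<in>?Inj. \<Sum>b\<in>S. c b * ((\<Sum>s\<in>S. c s * \<alpha> (\<sigma> s) x y) ^ q * (\<Prod>s\<in>S. \<alpha> (\<sigma> s) x y ^ (e(b := Suc (e b))) s)))" for x y
    proof (rule sum.cong[OF refl])
      fix \<sigma>
      have "(\<Sum>s\<in>S. c s * \<alpha> (\<sigma> s) x y) ^ Suc q * (\<Prod>s\<in>S. \<alpha> (\<sigma> s) x y ^ e s) =
        (\<Sum>b\<in>S. c b * ((\<Sum>s\<in>S. c s * \<alpha> (\<sigma> s) x y) ^ q * ((\<Prod>s\<in>S. \<alpha> (\<sigma> s) x y ^ e s) * \<alpha> (\<sigma> b) x y)))"
        by (simp add: sum_distrib_left sum_distrib_right mult_ac)
      thus "(\<Sum>s\<in>S. c s * \<alpha> (\<sigma> s) x y) ^ Suc q * (\<Prod>s\<in>S. \<alpha> (\<sigma> s) x y ^ e s) =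
         (\<Sum>b\<in>S. c b * ((\<Sum>s\<in>S. c s * \<alpha> (\<sigma> s) x y) ^ q * (\<Prod>s\<in>S. \<alpha> (\<sigma> s) x y ^ (e(b := Suc (e b))) s)))"
        by (simp add: upd cong: sum.cong del: fun_upd_apply)
    qed
    also have "\<And>x y. \<dots> x y = (\<Sum>b\<in>S. c b * (\<Sum>\<sigma>\<in>?Inj. (\<Sum>s\<in>S. c s * \<alpha> (\<sigma> s) x y) ^ q * (\<Prod>s\<in>S. \<alpha> (\<sigma> s) x y ^ (e(b := Suc (e b))) s)))"
      by (subst sum.swap) (simp only: sum_distrib_left)
    finally show ?case by (simp only:) (intro polynomial_fun2_diff polynomial_fun2_mult polynomial_fun2_sum polynomial_fun2_const Suc.IH)
  qed
  from this[of "\<lambda>_. 0"] show ?thesis by simp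
qed

section \<open>Values of linear forms in eigenvalues\<close>

lemma eig_mset_char_poly:
  assumes "char_poly M = (\<Prod>a\<leftarrow>as. [:- a, 1:])"
  shows "eig_mset M = mset as"
proof -
  have "proots (\<Prod>a\<leftarrow>as. [:- a, 1:]) = mset as" for as :: "complex list"
  proof (induction as)
    case (Cons a as)
    have "(\<Prod>a\<leftarrow>as. [:- a, 1:]) \<noteq> 0" for as :: "complex list"
      by (auto simp: prod_list_zero_iff)
    hence "proots ([:- a, 1:] * (\<Prod>a\<leftarrow>as. [:- a, 1:])) = {#a#} + mset as"
      by (subst proots_mult) (auto simp: Cons)
    thus ?case by simp
  qed auto
  thus ?thesis unfolding eig_mset_def assms .
qed

lemma eig_list:
  assumes "M \<in> carrier_mat n n"
  shows "mset (eig_list M) = eig_mset M" "length (eig_list M) = n"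
    and "char_poly M = (\<Prod>a\<leftarrow>eig_list M. [:- a, 1:])"
proof -
  obtain as where as: "char_poly M = (\<Prod>a\<leftarrow>as. [:- a, 1:])" "length as = n"
    using char_poly_factorized[OF assms] by blast
  have 1: "eig_mset M = mset as" by (rule eig_mset_char_poly[OF as(1)])
  show 2: "mset (eig_list M) = eig_mset M"
    unfolding eig_list_def 1 by (rule someI[of _ as]) simp
  have 3: "mset (eig_list M) = mset as" using 1 2 by simp
  show "length (eig_list M) = n" using as(2) mset_eq_length[OF 3] by simp
  have "(\<Prod>a\<leftarrow>as. [:- a, 1:]) = (\<Prod>a\<in>#mset as. [:- a, 1:])"
    by (metis mset_map prod_mset_prod_list)
  also have "\<dots> = (\<Prod>a\<leftarrow>eig_list M. [:- a, 1:])"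
    unfolding 3[symmetric] by (metis mset_map prod_mset_prod_list)
  finally show "char_poly M = (\<Prod>a\<leftarrow>eig_list M. [:- a, 1:])" using as(1) by simp
qed

section \<open>Index tuples, linear forms and permutations of the eigenvalues\<close>

lemma finite_supp_c [simp]: "finite (supp_c n c)"
  unfolding supp_c_def by simp

text \<open>Index tuples normalized outside the support by \<open>PiE\<close>. They form a finite
  set to sum over, in which tuples differing only off the support are identified.\<close>

definition injections :: "nat \<Rightarrow> (nat \<Rightarrow> real) \<Rightarrow> (nat \<Rightarrow> nat) set" where
  "injections n c = {\<sigma> \<in> supp_c n c \<rightarrow>\<^sub>E {..<n}. inj_on \<sigma> (supp_c n c)}"

lemma finite_injections [simp]: "finite (injections n c)"
  unfolding injections_def
  by (rule finite_subset[OF _ finite_PiE[OF finite_supp_c, of n c "\<lambda>_. {..<n}"]]) auto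

lemma lin_form_cong:
  assumes "\<And>s. s \<in> supp_c n c \<Longrightarrow> \<sigma> s = \<tau> s"
  shows "lin_form n c \<sigma> = lin_form n c \<tau>"
proof
  fix k
  have "{i \<in> supp_c n c. \<sigma> i = k} = {i \<in> supp_c n c. \<tau> i = k}" using assms by auto
  thus "lin_form n c \<sigma> k = lin_form n c \<tau> k" unfolding lin_form_def by simp
qed

lemma forms_eq_injections: "forms n c = lin_form n c ` injections n c"
proof safe
  fix f assume "f \<in> forms n c"
  then obtain \<sigma> where \<sigma>: "f = lin_form n c \<sigma>" "index_tuple n c \<sigma>" unfolding forms_def by auto
  have "restrict \<sigma> (supp_c n c) \<in> injections n c"
    using \<sigma>(2) unfolding index_tuple_def injections_def by auto
  moreover have "f = lin_form n c (restrict \<sigma> (supp_c n c))"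
    unfolding \<sigma> by (rule lin_form_cong) auto
  ultimately show "f \<in> lin_form n c ` injections n c" by blast
next
  fix \<sigma> assume "\<sigma> \<in> injections n c"
  thus "lin_form n c \<sigma> \<in> forms n c" unfolding forms_def index_tuple_def injections_def by auto
qed

lemma finite_forms [simp]: "finite (forms n c)"
  unfolding forms_eq_injections by simp

lemma index_tuple_id: "index_tuple n c id"
  unfolding index_tuple_def supp_c_def by auto

lemma forms_nonempty: "forms n c \<noteq> {}"
  unfolding forms_def using index_tuple_id by auto

lemma deg_c_pos: "deg_c n c > 0"
  unfolding deg_c_def using forms_nonempty by (simp add: card_gt_0_iff)

lemma sum_lin_form:
  fixes h :: "nat \<Rightarrow> complex"
  assumes "\<sigma> ` supp_c n c \<subseteq> {..<n}"
  shows "(\<Sum>k<n. of_real (lin_form n c \<sigma> k) * h k) = (\<Sum>s\<in>supp_c n c. of_real (c s) * h (\<sigma> s))"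
proof -
  have "(\<Sum>s\<in>supp_c n c. of_real (c s) * h (\<sigma> s)) =
      (\<Sum>k<n. \<Sum>s\<in>{s\<in>supp_c n c. \<sigma> s = k}. of_real (c s) * h (\<sigma> s))"
    by (rule sum.group[symmetric]) (use assms in auto)
  also have "\<dots> = (\<Sum>k<n. of_real (lin_form n c \<sigma> k) * h k)"
    unfolding lin_form_def by (simp add: sum_distrib_right)
  finally show ?thesis by simp
qed

lemma lin_form_comp_permutation:
  assumes "\<pi> permutes S"
  shows "lin_form n c \<sigma> \<circ> \<pi> = lin_form n c (inv_into UNIV \<pi> \<circ> \<sigma>)"
proof
  fix k
  have "{i \<in> supp_c n c. \<sigma> i = \<pi> k} = {i \<in> supp_c n c. (inv_into UNIV \<pi> \<circ> \<sigma>) i = k}"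
    using assms permutes_inverses by (auto simp: permutes_inverses)
  thus "(lin_form n c \<sigma> \<circ> \<pi>) k = lin_form n c (inv_into UNIV \<pi> \<circ> \<sigma>) k" unfolding lin_form_def by simp
qed

lemma index_tuple_comp_permutation:
  assumes "\<pi> permutes {..<n}" "index_tuple n c \<sigma>"
  shows "index_tuple n c (\<pi> \<circ> \<sigma>)"
proof -
  have "inj_on (\<pi> \<circ> \<sigma>) (supp_c n c)"
    using assms(2) by (intro comp_inj_on inj_on_subset[OF permutes_inj[OF assms(1)]]) (auto simp: index_tuple_def)
  moreover have "\<pi> ` {..<n} = {..<n}" by (rule permutes_image[OF assms(1)])
  ultimately show ?thesis using assms(2) unfolding index_tuple_def by auto
qed

lemma forms_comp_permutation:
  assumes \<pi>: "\<pi> permutes {..<n}" and "f \<in> forms n c"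
  shows "f \<circ> \<pi> \<in> forms n c"
proof -
  obtain \<sigma> where \<sigma>: "f = lin_form n c \<sigma>" "index_tuple n c \<sigma>" using assms(2) unfolding forms_def by auto
  show ?thesis unfolding \<sigma> lin_form_comp_permutation[OF \<pi>] forms_def
    using index_tuple_comp_permutation[OF permutes_inv[OF \<pi>] \<sigma>(2)] by auto
qed

lemma prod_forms_comp_permutation:
  assumes \<pi>: "\<pi> permutes {..<n}"
  shows "(\<Prod>f\<in>forms n c. G (f \<circ> \<pi>)) = (\<Prod>f\<in>forms n c. G f)"
proof (rule prod.reindex_bij_witness[where i="\<lambda>f. f \<circ> inv_into UNIV \<pi>" and j="\<lambda>f. f \<circ> \<pi>"])
  fix f assume f: "f \<in> forms n c"
  show "f \<circ> \<pi> \<in> forms n c" "f \<circ> inv_into UNIV \<pi> \<in> forms n c"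
    using forms_comp_permutation f \<pi> permutes_inv[OF \<pi>] by auto
  show "f \<circ> \<pi> \<circ> inv_into UNIV \<pi> = f" "f \<circ> inv_into UNIV \<pi> \<circ> \<pi> = f"
    using permutes_inv_o[OF \<pi>] by (simp_all add: comp_assoc)
qed auto

text \<open>The eigenvalue list is an argument, so that the arbitrary \<open>eig_list\<close> can be
  replaced by a scaled or sorted list of the same eigenvalues.\<close>

definition value_poly :: "nat \<Rightarrow> (nat \<Rightarrow> real) \<Rightarrow> complex list \<Rightarrow> complex poly" where
  "value_poly n c xs = (\<Prod>f\<in>forms n c. [:- (\<Sum>k<n. of_real (f k) * xs ! k), 1:])"

lemma p_poly_value_poly: "p_poly n M c = value_poly n c (eig_list M)"
  unfolding p_poly_def value_poly_def ..

text \<open>Reordering the list amounts to permuting the variables of the linear forms, and the set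
  of all forms is stable under this. Hence the choice made in \<open>eig_list\<close> does not
  affect \<open>p_poly\<close>.\<close>

lemma value_poly_cong_mset:
  assumes "mset xs = mset ys" "length xs = n"
  shows "value_poly n c xs = value_poly n c ys"
proof -
  obtain \<pi> where \<pi>: "\<pi> permutes {..<length ys}" "permute_list \<pi> ys = xs"
    using mset_eq_permutation[OF assms(1)] by blast
  have len: "length ys = n" using assms mset_eq_length by metis
  note \<pi> = \<pi>[unfolded len]
  have *: "xs ! k = ys ! \<pi> k" if "k < n" for k
    using that \<pi> len by (metis permute_list_nth)
  have "(\<Sum>k<n. of_real ((f \<circ> \<pi>) k) * xs ! k) = (\<Sum>k<n. of_real (f k) * ys ! k)" for f :: "nat \<Rightarrow> real"
  proof -
    have "(\<Sum>k<n. of_real (f k) * ys ! k) = (\<Sum>k<n. of_real (f (\<pi> k)) * ys ! \<pi> k)"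
      by (rule sum.permute[OF \<pi>(1), unfolded comp_def])
    thus ?thesis by (simp add: *)
  qed
  hence "value_poly n c ys = (\<Prod>f\<in>forms n c. [:- (\<Sum>k<n. of_real ((f \<circ> \<pi>) k) * xs ! k), 1:])"
    unfolding value_poly_def by simp
  also have "\<dots> = value_poly n c xs"
    unfolding value_poly_def by (rule prod_forms_comp_permutation[OF \<pi>(1)])
  finally show ?thesis by simp
qed

lemma value_poly_root_iff:
  "poly (value_poly n c xs) v = 0 \<longleftrightarrow>
     (\<exists>\<sigma>. index_tuple n c \<sigma> \<and> v = (\<Sum>s\<in>supp_c n c. of_real (c s) * xs ! \<sigma> s))"
proof -
  have "poly (value_poly n c xs) v = 0 \<longleftrightarrow> (\<exists>f\<in>forms n c. v = (\<Sum>k<n. of_real (f k) * xs ! k))"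
    unfolding value_poly_def poly_prod by (auto simp: prod_zero_iff eq_neg_iff_add_eq_0 algebra_simps)
  also have "\<dots> \<longleftrightarrow> (\<exists>\<sigma>. index_tuple n c \<sigma> \<and> v = (\<Sum>s\<in>supp_c n c. of_real (c s) * xs ! \<sigma> s))"
    unfolding forms_def by (auto simp: sum_lin_form index_tuple_def)
  finally show ?thesis .
qed

lemma c_value_iff_root: "c_value n M c v \<longleftrightarrow> poly (p_poly n M c) v = 0"
  unfolding p_poly_value_poly value_poly_root_iff c_value_def ..

lemma p_poly_monic: "degree (p_poly n M c) = deg_c n c" "coeff (p_poly n M c) (deg_c n c) = 1"
  unfolding p_poly_def deg_c_def by (rule monic_prod_linear, simp)+

text \<open>The complements of the two images in \<open>{..<n}\<close> have equal size, so any
  bijection between them completes the partial map.\<close>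

lemma ex_permutation_extending:
  fixes \<sigma> \<tau> :: "'b \<Rightarrow> nat"
  assumes "inj_on \<sigma> S" "inj_on \<tau> S" "\<sigma> ` S \<subseteq> {..<n}" "\<tau> ` S \<subseteq> {..<n}"
  shows "\<exists>\<pi>. \<pi> permutes {..<n} \<and> (\<forall>s\<in>S. \<pi> (\<sigma> s) = \<tau> s)"
proof -
  have fin: "finite (\<sigma> ` S)" "finite (\<tau> ` S)" using assms(3,4) finite_subset by blast+
  have "card (\<sigma> ` S) = card (\<tau> ` S)" using assms by (simp add: card_image)
  hence "card ({..<n} - \<sigma> ` S) = card ({..<n} - \<tau> ` S)"
    using assms fin by (simp add: card_Diff_subset)
  then obtain h where h: "bij_betw h ({..<n} - \<sigma> ` S) ({..<n} - \<tau> ` S)"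
    using finite_same_card_bij by (metis finite_Diff finite_lessThan)
  define \<pi> where "\<pi> x = (if x \<in> \<sigma> ` S then \<tau> (inv_into S \<sigma> x) else if x < n then h x else x)" for x
  have on_S: "\<pi> (\<sigma> s) = \<tau> s" if "s \<in> S" for s
    unfolding \<pi>_def using that assms(1) by simp
  have "bij_betw \<pi> (\<sigma> ` S) (\<tau> ` S)"
  proof (rule bij_betw_imageI)
    show "inj_on \<pi> (\<sigma> ` S)" using assms(2) by (auto simp: inj_on_def on_S)
    show "\<pi> ` \<sigma> ` S = \<tau> ` S" by (auto simp: image_image on_S)
  qed
  moreover have "bij_betw \<pi> ({..<n} - \<sigma> ` S) ({..<n} - \<tau> ` S)"
    by (rule bij_betw_cong[THEN iffD1, OF _ h]) (auto simp: \<pi>_def)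
  ultimately have "bij_betw \<pi> (\<sigma> ` S \<union> ({..<n} - \<sigma> ` S)) (\<tau> ` S \<union> ({..<n} - \<tau> ` S))"
    by (rule bij_betw_combine) auto
  moreover have "\<sigma> ` S \<union> ({..<n} - \<sigma> ` S) = {..<n}" "\<tau> ` S \<union> ({..<n} - \<tau> ` S) = {..<n}"
    using assms by auto
  ultimately have "bij_betw \<pi> {..<n} {..<n}" by simp
  hence "\<pi> permutes {..<n}"
    by (rule bij_imp_permutes) (use assms(3) in \<open>auto simp: \<pi>_def\<close>)
  thus ?thesis using on_S by blast
qed

text \<open>Every linear form comes from the same number of injections, because the symmetric group acts
  transitively on them.\<close>
lemma card_fiber_lin_form:
  assumes "\<sigma> \<in> injections n c" "\<tau> \<in> injections n c"
  shows "card {\<rho> \<in> injections n c. lin_form n c \<rho> = lin_form n c \<sigma>} =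
    card {\<rho> \<in> injections n c. lin_form n c \<rho> = lin_form n c \<tau>}"
proof -
  let ?S = "supp_c n c"
  have le: "card {\<rho> \<in> injections n c. lin_form n c \<rho> = lin_form n c \<sigma>} \<le>
    card {\<rho> \<in> injections n c. lin_form n c \<rho> = lin_form n c \<tau>}"
    if \<sigma>\<tau>: "\<sigma> \<in> injections n c" "\<tau> \<in> injections n c" for \<sigma> \<tau>
  proof -
    obtain \<pi> where \<pi>: "\<pi> permutes {..<n}" and on_S: "\<And>s. s \<in> ?S \<Longrightarrow> \<pi> (\<sigma> s) = \<tau> s"
      using \<sigma>\<tau> ex_permutation_extending[of \<sigma> ?S \<tau> n] unfolding injections_def by blast
    let ?g = "\<lambda>\<rho>. restrict (\<pi> \<circ> \<rho>) ?S"
    have lf: "lin_form n c (?g \<rho>) = lin_form n c \<rho> \<circ> inv_into UNIV \<pi>" for \<rho>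
      using lin_form_comp_permutation[OF permutes_inv[OF \<pi>], of n c \<rho>] permutes_inv_inv[OF \<pi>]
      by (subst lin_form_cong[of n c _ "\<pi> \<circ> \<rho>"]) auto
    have "lin_form n c \<sigma> \<circ> inv_into UNIV \<pi> = lin_form n c \<tau>"
      unfolding lf[symmetric] by (rule lin_form_cong) (auto simp: on_S)
    moreover have "?g \<rho> \<in> injections n c" if "\<rho> \<in> injections n c" for \<rho>
    proof -
      have "index_tuple n c \<rho>" using that unfolding injections_def index_tuple_def by auto
      from index_tuple_comp_permutation[OF \<pi> this] show ?thesis
        unfolding injections_def index_tuple_def by auto
    qed
    moreover have "inj_on ?g (injections n c)"
    proof (rule inj_onI)
      fix \<rho> \<rho>' assume \<rho>: "\<rho> \<in> injections n c" "\<rho>' \<in> injections n c" and eq: "?g \<rho> = ?g \<rho>'"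
      have "\<rho> s = \<rho>' s" if "s \<in> ?S" for s
        using fun_cong[OF eq, of s] that permutes_inj[OF \<pi>] by (auto dest: injD)
      moreover have "\<rho> \<in> extensional ?S" "\<rho>' \<in> extensional ?S"
        using \<rho> unfolding injections_def PiE_def by auto
      ultimately show "\<rho> = \<rho>'" by (metis extensionalityI)
    qed
    ultimately show ?thesis
      by (intro card_inj_on_le[of ?g]) (auto simp: lf intro: inj_on_subset)
  qed
  show ?thesis using le[of \<sigma> \<tau>] le[of \<tau> \<sigma>] assms by simp
qed

text \<open>Symmetric functions of the eigenvalues arise as sums over injections, while
  \<open>p_poly\<close> takes every form once. The constant fibre size K converts one sum into the
  other, and K > 0 permits division.\<close>

lemma ex_sum_injections_eq_sum_forms:
  "\<exists>K>0. \<forall>G :: (nat \<Rightarrow> real) \<Rightarrow> complex.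
     (\<Sum>\<sigma>\<in>injections n c. G (lin_form n c \<sigma>)) = of_nat K * (\<Sum>f\<in>forms n c. G f)"
proof -
  obtain \<sigma>0 where \<sigma>0: "\<sigma>0 \<in> injections n c"
    using forms_nonempty[of n c] unfolding forms_eq_injections by blast
  define fib where "fib f = {\<rho> \<in> injections n c. lin_form n c \<rho> = f}" for f
  define K where "K = card (fib (lin_form n c \<sigma>0))"
  have K: "card (fib f) = K" if "f \<in> forms n c" for f
    using that card_fiber_lin_form[OF \<sigma>0] unfolding forms_eq_injections K_def fib_def by fastforce
  have "K > 0" unfolding K_def fib_def using \<sigma>0 by (subst card_gt_0_iff) auto
  moreover have "(\<Sum>\<sigma>\<in>injections n c. G (lin_form n c \<sigma>)) = of_nat K * (\<Sum>f\<in>forms n c. G f)"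
    for G :: "(nat \<Rightarrow> real) \<Rightarrow> complex"
  proof -
    have "(\<Sum>\<sigma>\<in>injections n c. G (lin_form n c \<sigma>)) =
        (\<Sum>f\<in>forms n c. \<Sum>\<sigma>\<in>fib f. G (lin_form n c \<sigma>))"
      unfolding fib_def
      by (rule sum.group[symmetric]) (auto simp: forms_eq_injections)
    also have "\<dots> = (\<Sum>f\<in>forms n c. \<Sum>\<sigma>\<in>fib f. G f)"
      by (intro sum.cong) (auto simp: fib_def)
    also have "\<dots> = of_nat K * (\<Sum>f\<in>forms n c. G f)"
      by (simp add: K sum_distrib_left)
    finally show ?thesis .
  qed
  ultimately show ?thesis by blast
qed

section \<open>The pencil x A + y A* and the polynomial \<open>r_poly\<close>\<close>

abbreviation pencil :: "complex mat \<Rightarrow> complex \<Rightarrow> complex \<Rightarrow> complex mat" where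
  "pencil A x y \<equiv> x \<cdot>\<^sub>m A + y \<cdot>\<^sub>m mat_adjoint A"

lemma mat_adjoint_carrier:
  assumes "A \<in> carrier_mat n m"
  shows "mat_adjoint A \<in> carrier_mat m n"
  using assms unfolding mat_adjoint_def by (auto simp: mat_of_rows_def)

lemma mat_adjoint_index:
  assumes "A \<in> carrier_mat n m" "i < m" "j < n"
  shows "mat_adjoint A $$ (i, j) = cnj (A $$ (j, i))"
  using assms unfolding mat_adjoint_def by (auto simp: mat_of_rows_def)

lemma pencil_carrier:
  assumes "A \<in> carrier_mat n n"
  shows "pencil A x y \<in> carrier_mat n n"
  using assms mat_adjoint_carrier[OF assms] by auto

lemma H_theta_pencil:
  assumes A: "A \<in> carrier_mat n n"
  shows "H_theta \<theta> A = pencil A (cis \<theta> / 2) (cis (- \<theta>) / 2)"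
proof -
  have "exp (\<i> * of_real \<theta>) = cis \<theta>" "exp (- \<i> * of_real \<theta>) = cis (- \<theta>)"
    by (simp_all add: cis_conv_exp)
  thus ?thesis unfolding H_theta_def
    by (intro eq_matI) (use A mat_adjoint_carrier[OF A] in \<open>auto simp: algebra_simps\<close>)
qed

lemma prod_list_eq_prod_nth:
  fixes g :: "'a \<Rightarrow> 'b :: comm_monoid_mult"
  shows "(\<Prod>a\<leftarrow>xs. g a) = (\<Prod>k<length xs. g (xs ! k))"
  by (induction xs rule: rev_induct) (simp_all add: nth_append mult.commute)

lemma polynomial_fun2_char_poly:
  assumes A: "A \<in> carrier_mat n n"
  shows "polynomial_fun2 (\<lambda>x y. coeff (char_poly (pencil A x y)) l)"
proof -
  \<comment> \<open>The entries encode x A + y A* over C[x][y], the outer variable being y.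
    Specialization by \<open>eval2\<close> then commutes with the characteristic polynomial.\<close>
  define M where "M = Matrix.mat n n (\<lambda>(i,j). [:[:0, A $$ (i,j):], [:mat_adjoint A $$ (i,j):]:])"
  have M: "M \<in> carrier_mat n n" unfolding M_def by simp
  have "pencil A x y = map_mat (eval2 x y) M" for x y
    by (intro eq_matI) (use A mat_adjoint_carrier[OF A] in \<open>auto simp: M_def eval2_def algebra_simps\<close>)
  hence "coeff (char_poly (pencil A x y)) l = eval2 x y (coeff (char_poly M) l)" for x y
    by (simp add: eval2.char_poly_hom[OF M])
  thus ?thesis unfolding polynomial_fun2_def by blast
qed

text \<open>Newton's identities lead from the coefficients of the characteristic polynomial to power
  sums of the eigenvalues, hence to power sums of the values over all injections. Division by K
  gives the power sums over forms, and Newton's identities lead back to coefficients.\<close>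

lemma polynomial_fun2_p_poly:
  assumes A: "A \<in> carrier_mat n n"
  shows "polynomial_fun2 (\<lambda>x y. coeff (p_poly n (pencil A x y) c) l)"
proof -
  define \<alpha> where "\<alpha> k x y = eig_list (pencil A x y) ! k" for k x y
  have "char_poly (pencil A x y) = (\<Prod>k<n. [:- \<alpha> k x y, 1:])" for x y
    using eig_list(2,3)[OF pencil_carrier[OF A], of x y]
    by (simp add: prod_list_eq_prod_nth \<alpha>_def)
  hence "polynomial_fun2 (\<lambda>x y. \<Sum>k<n. \<alpha> k x y ^ q)" for q
    using polynomial_fun2_char_poly[OF A] by (intro polynomial_fun2_power_sums) auto
  from polynomial_fun2_linear_form_power_sum[OF finite_supp_c[of n c] this, of "\<lambda>s. of_real (c s)"]
  have inj: "polynomial_fun2 (\<lambda>x y. \<Sum>\<sigma>\<in>injections n c. (\<Sum>s\<in>supp_c n c. of_real (c s) * \<alpha> (\<sigma> s) x y) ^ q)" for q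
    unfolding injections_def by blast
  define v where "v f x y = (\<Sum>k<n. of_real (f k) * \<alpha> k x y)" for f :: "nat \<Rightarrow> real" and x y
  obtain K where K: "K > 0" "\<And>G :: (nat \<Rightarrow> real) \<Rightarrow> complex.
     (\<Sum>\<sigma>\<in>injections n c. G (lin_form n c \<sigma>)) = of_nat K * (\<Sum>f\<in>forms n c. G f)"
    using ex_sum_injections_eq_sum_forms by metis
  have "(\<Sum>f\<in>forms n c. v f x y ^ q) = 1 / of_nat K *
     (\<Sum>\<sigma>\<in>injections n c. (\<Sum>s\<in>supp_c n c. of_real (c s) * \<alpha> (\<sigma> s) x y) ^ q)" for x y q
  proof -
    have "(\<Sum>\<sigma>\<in>injections n c. (\<Sum>s\<in>supp_c n c. of_real (c s) * \<alpha> (\<sigma> s) x y) ^ q) =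
       (\<Sum>\<sigma>\<in>injections n c. v (lin_form n c \<sigma>) x y ^ q)"
      unfolding v_def by (intro sum.cong refl, subst sum_lin_form) (auto simp: injections_def)
    also have "\<dots> = of_nat K * (\<Sum>f\<in>forms n c. v f x y ^ q)" by (rule K(2))
    finally show ?thesis using K(1) by simp
  qed
  hence "polynomial_fun2 (\<lambda>x y. \<Sum>f\<in>forms n c. v f x y ^ q)" for q
    by (simp only:) (intro polynomial_fun2_mult polynomial_fun2_const inj)
  hence "polynomial_fun2 (\<lambda>x y. coeff (\<Prod>f\<in>forms n c. [:- v f x y, 1:]) l)"
    by (intro polynomial_fun2_coeffs) auto
  thus ?thesis unfolding p_poly_def v_def \<alpha>_def .
qed

lemma poly_eq_0_infinite:
  fixes p :: "'a :: idom poly"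
  assumes "infinite S" "\<And>s. s \<in> S \<Longrightarrow> poly p s = 0"
  shows "p = 0"
  using assms poly_roots_finite[of p] finite_subset[of S "{x. poly p x = 0}"] by blast

text \<open>A nonzero polynomial over the domain C[x] cannot vanish at infinitely many constants
  \<open>[:y:]\<close>. The value y = 0 is left out because the chart y = 1 used for Bezout's
  theorem reaches only nonzero y.\<close>

lemma eval2_eq_0:
  assumes "\<And>x y. y \<noteq> 0 \<Longrightarrow> eval2 x y p = 0"
  shows "p = 0"
proof (rule poly_eq_0_infinite)
  have "infinite (- {0 :: complex})" using infinite_UNIV_char_0 by (metis finite_compl finite.emptyI finite_insert)
  thus "infinite ((\<lambda>y :: complex. [:y:]) ` (- {0}))"
    by (subst finite_image_iff) (auto simp: inj_on_def)
  fix s assume "s \<in> (\<lambda>y :: complex. [:y:]) ` (- {0})"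
  then obtain y where y: "y \<noteq> 0" "s = [:y:]" by auto
  show "poly p s = 0"
    by (rule poly_eq_0_infinite[OF infinite_UNIV_char_0]) (use assms[OF y(1)] y(2) in \<open>simp add: eval2_def\<close>)
qed

lemma map_poly_eval2_inject:
  assumes "\<And>x y. map_poly (eval2 x y) p = map_poly (eval2 x y) q"
  shows "p = q"
proof (rule poly_eqI)
  fix i
  have "eval2 x y (coeff p i - coeff q i) = 0" for x y
    using arg_cong[OF assms[of x y], of "\<lambda>p. coeff p i"] by (simp add: eval2.hom_minus)
  from eval2_eq_0[OF this] show "coeff p i = coeff q i" by simp
qed

lemma eval3_eq: "eval3 q x y t = poly (map_poly (eval2 x y) q) t"
proof -
  have "eval3 q x y t = eval2 x y (poly q [:[:t:]:])" by (simp add: eval3_def eval2_def)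
  also have "\<dots> = poly (map_poly (eval2 x y) q) (eval2 x y [:[:t:]:])"
    by (rule eval2.poly_map_poly[symmetric])
  finally show ?thesis by (simp add: eval2_def)
qed

text \<open>This justifies the \<open>THE\<close> in \<open>r_poly\<close>: existence comes from the
  polynomial coefficients, uniqueness from the fact that values at all complex points determine a
  polynomial.\<close>

lemma map_poly_r_poly:
  assumes A: "A \<in> carrier_mat n n"
  shows "map_poly (eval2 x y) (r_poly n A c) = p_poly n (pencil A x y) c"
proof -
  have "\<forall>l. \<exists>q. \<forall>x y. coeff (p_poly n (pencil A x y) c) l = eval2 x y q"
    using polynomial_fun2_p_poly[OF A] unfolding polynomial_fun2_def by blast
  then obtain Q where Q: "\<And>l x y. coeff (p_poly n (pencil A x y) c) l = eval2 x y (Q l)" by metis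
  define q where "q = (\<Sum>l\<le>deg_c n c. monom (Q l) l)"
  have q: "map_poly (eval2 x y) q = p_poly n (pencil A x y) c" for x y
  proof (rule poly_eqI)
    fix i
    have "coeff q i = (if i \<le> deg_c n c then Q i else 0)"
      unfolding q_def by (auto simp: coeff_sum)
    thus "coeff (map_poly (eval2 x y) q) i = coeff (p_poly n (pencil A x y) c) i"
      by (auto simp: Q[symmetric] coeff_eq_0 p_poly_monic)
  qed
  have "r_poly n A c = q" unfolding r_poly_def
  proof (rule the_equality)
    show "\<forall>x y t. eval3 q x y t = poly (p_poly n (pencil A x y) c) t" by (simp add: eval3_eq q)
    fix q' assume "\<forall>x y t. eval3 q' x y t = poly (p_poly n (pencil A x y) c) t"
    hence "map_poly (eval2 x y) q' = map_poly (eval2 x y) q" for x y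
      by (simp add: eval3_eq q poly_eq_poly_eq_iff[symmetric] fun_eq_iff)
    thus "q' = q" by (rule map_poly_eval2_inject)
  qed
  thus ?thesis using q by simp
qed

lemma r_poly_monic:
  assumes A: "A \<in> carrier_mat n n"
  shows "degree (r_poly n A c) = deg_c n c" "coeff (r_poly n A c) (deg_c n c) = 1"
proof -
  have ev: "eval2 x y (coeff (r_poly n A c) i) = coeff (p_poly n (pencil A x y) c) i" for x y i
    unfolding map_poly_r_poly[OF A, symmetric] by simp
  have "eval2 x y (coeff (r_poly n A c) (deg_c n c) - 1) = 0" for x y
    by (simp add: eval2.hom_minus ev p_poly_monic)
  from eval2_eq_0[OF this] show 1: "coeff (r_poly n A c) (deg_c n c) = 1" by simp
  have "coeff (r_poly n A c) i = 0" if "i > deg_c n c" for i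
    by (rule eval2_eq_0) (use that in \<open>simp add: ev coeff_eq_0 p_poly_monic\<close>)
  hence "degree (r_poly n A c) \<le> deg_c n c" by (intro degree_le) auto
  moreover have "deg_c n c \<le> degree (r_poly n A c)" using 1 by (intro le_degree) simp
  ultimately show "degree (r_poly n A c) = deg_c n c" by simp
qed

text \<open>The reason is det (t I - s M) = s ^ n det ((t / s) I - M). Both sides are compared as
  functions of t, which determines the polynomial.\<close>

lemma eig_mset_smult:
  assumes M: "M \<in> carrier_mat n n" and s: "s \<noteq> 0"
  shows "eig_mset (s \<cdot>\<^sub>m M) = image_mset ((*) s) (eig_mset M)"
proof -
  let ?xs = "eig_list M"
  have scale: "s ^ length xs * (\<Prod>a\<leftarrow>xs. t / s - a) = (\<Prod>a\<leftarrow>xs. t - s * a)" for xs t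
    by (induction xs) (use s in \<open>auto simp: field_simps\<close>)
  have "poly (char_poly (s \<cdot>\<^sub>m M)) t = poly (\<Prod>a\<leftarrow>map ((*) s) ?xs. [:- a, 1:]) t" for t
  proof -
    have sM: "s \<cdot>\<^sub>m M \<in> carrier_mat n n" using M by simp
    have "- char_matrix (s \<cdot>\<^sub>m M) t = s \<cdot>\<^sub>m (- char_matrix M (t / s))"
      by (intro eq_matI) (use M s in \<open>auto simp: char_matrix_def field_simps\<close>)
    hence "poly (char_poly (s \<cdot>\<^sub>m M)) t = s ^ n * poly (char_poly M) (t / s)"
      unfolding char_poly_matrix[OF sM] char_poly_matrix[OF M]
      using M by (simp add: char_matrix_def)
    also have "\<dots> = s ^ length ?xs * (\<Prod>a\<leftarrow>?xs. t / s - a)"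
      by (subst eig_list(3)[OF M]) (simp add: poly_prod_list o_def eig_list(2)[OF M])
    also have "\<dots> = (\<Prod>a\<leftarrow>?xs. t - s * a)"
      by (rule scale)
    finally show ?thesis by (simp add: poly_prod_list o_def)
  qed
  hence "char_poly (s \<cdot>\<^sub>m M) = (\<Prod>a\<leftarrow>map ((*) s) ?xs. [:- a, 1:])"
    by (simp add: poly_eq_poly_eq_iff[symmetric] fun_eq_iff)
  from eig_mset_char_poly[OF this] show ?thesis by (simp add: eig_list(1)[OF M])
qed

lemma p_poly_smult:
  assumes M: "M \<in> carrier_mat n n" and s: "s \<noteq> 0"
  shows "poly (p_poly n (s \<cdot>\<^sub>m M) c) (s * t) = s ^ deg_c n c * poly (p_poly n M c) t"
proof -
  have sM: "s \<cdot>\<^sub>m M \<in> carrier_mat n n" using M by simp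
  have "p_poly n (s \<cdot>\<^sub>m M) c = value_poly n c (map ((*) s) (eig_list M))"
    unfolding p_poly_value_poly
    by (rule value_poly_cong_mset) (simp_all add: eig_list[OF sM] eig_list[OF M] eig_mset_smult[OF M s])
  also have "poly \<dots> (s * t) = (\<Prod>f\<in>forms n c. s * (t - (\<Sum>k<n. of_real (f k) * eig_list M ! k)))"
    unfolding value_poly_def poly_prod
    by (intro prod.cong) (auto simp: eig_list(2)[OF M] algebra_simps sum_distrib_left)
  also have "\<dots> = s ^ deg_c n c * poly (p_poly n M c) t"
    by (simp add: prod.distrib deg_c_def p_poly_def poly_prod)
  finally show ?thesis .
qed

text \<open>The homogeneity of \<open>r_poly\<close>, expressed through values. It moves zeros into
  and out of the chart y = 1 and bounds the degrees of the coefficients in x.\<close>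

lemma p_poly_pencil_scale:
  assumes A: "A \<in> carrier_mat n n" and s: "s \<noteq> 0"
  shows "poly (p_poly n (pencil A (s * x) (s * y)) c) (s * t) = s ^ deg_c n c * poly (p_poly n (pencil A x y) c) t"
proof -
  have "pencil A (s * x) (s * y) = s \<cdot>\<^sub>m pencil A x y"
    by (intro eq_matI) (use A mat_adjoint_carrier[OF A] in \<open>auto simp: algebra_simps\<close>)
  thus ?thesis using p_poly_smult[OF pencil_carrier[OF A] s] by simp
qed

section \<open>Resultants and Bezout's theorem\<close>

text \<open>With both exponents of \<open>sylvester_index_mat2\<close> lowered by one, a row is seen
  to list the coefficients of a shift of f or g from degree m + n - 1 down to 0.\<close>

lemma sylvester_mat_index_shift:
  fixes f g :: "'a :: comm_semiring_1 poly"
  defines "m \<equiv> degree f" and "n \<equiv> degree g"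
  assumes "i < m + n" "j < m + n"
  shows "sylvester_mat f g $$ (i, j) =
    coeff (if i < n then monom 1 (n - 1 - i) * f else monom 1 (m + n - 1 - i) * g) (m + n - 1 - j)"
proof -
  have *: "coeff (monom 1 (Suc k) * p) (Suc l) = coeff (monom 1 k * p) l" for k l and p :: "'a poly"
    by (simp add: coeff_monom_mult)
  have "n - i = Suc (n - 1 - i)" if "i < n" using that by simp
  moreover have "m + n - i = Suc (m + n - 1 - i)" "m + n - j = Suc (m + n - 1 - j)" using assms by auto
  ultimately show ?thesis
    unfolding sylvester_index_mat2[OF assms(3,4)[unfolded m_def n_def], folded m_def n_def]
    by (simp add: *)
qed

lemma sum_rev_coeffs:
  fixes p :: "'a :: comm_semiring_1 poly"
  assumes "degree p < N"
  shows "(\<Sum>j<N. coeff p (N - 1 - j) * t ^ (N - 1 - j)) = poly p t"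
proof -
  have "(\<Sum>j<N. coeff p (N - 1 - j) * t ^ (N - 1 - j)) = (\<Sum>l<N. coeff p l * t ^ l)"
    by (rule sum.reindex_bij_witness[where i="\<lambda>l. N - 1 - l" and j="\<lambda>l. N - 1 - l"]) auto
  also have "\<dots> = (\<Sum>l\<le>degree p. coeff p l * t ^ l)"
    by (rule sum.mono_neutral_right) (use assms in \<open>auto simp: coeff_eq_0\<close>)
  finally show ?thesis by (simp add: poly_altdef)
qed

lemma degree_monom_1_mult:
  fixes p :: "'a :: idom poly"
  shows "degree (monom 1 k * p) \<le> k + degree p"
  using degree_mult_le[of "monom 1 k" p] by (simp add: degree_monom_eq)

text \<open>Pairing a row with powers of t evaluates the polynomial listed in it. This puts the
  power vector of a common root into the kernel, and it computes the product with a Vandermonde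
  matrix.\<close>

lemma sylvester_mat_power_vector:
  fixes f g :: "'a :: idom poly"
  defines "m \<equiv> degree f" and "n \<equiv> degree g"
  assumes i: "i < m + n"
  shows "(\<Sum>j<m+n. sylvester_mat f g $$ (i, j) * t ^ (m + n - 1 - j)) =
    (if i < n then t ^ (n - 1 - i) * poly f t else t ^ (m + n - 1 - i) * poly g t)"
proof -
  define p where "p = (if i < n then monom 1 (n - 1 - i) * f else monom 1 (m + n - 1 - i) * g)"
  have "degree p < m + n"
    using i degree_monom_1_mult[of "n - 1 - i" f] degree_monom_1_mult[of "m + n - 1 - i" g]
    unfolding p_def m_def[symmetric] n_def[symmetric] by (auto split: if_splits)
  have "(\<Sum>j<m+n. sylvester_mat f g $$ (i, j) * t ^ (m + n - 1 - j)) =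
      (\<Sum>j<m+n. coeff p (m + n - 1 - j) * t ^ (m + n - 1 - j))"
    unfolding p_def m_def n_def
    by (intro sum.cong refl, subst sylvester_mat_index_shift) (use i in \<open>auto simp: m_def n_def\<close>)
  also have "\<dots> = poly p t" by (rule sum_rev_coeffs[OF \<open>degree p < m + n\<close>])
  finally show ?thesis by (simp add: p_def poly_monom)
qed

text \<open>A kernel vector of the transposed Sylvester matrix is a linear relation between shifts
  of f and g, and its entries are the coefficients of the cofactors. The generality of a domain
  allows coefficients in C[x][y].\<close>

lemma resultant_eq_0_imp_relation:
  fixes f g :: "'a :: idom poly"
  assumes "resultant f g = 0"
  obtains a b where "a * f + b * g = 0" "a \<noteq> 0 \<or> b \<noteq> 0"
    "a \<noteq> 0 \<Longrightarrow> degree a < degree g" "b \<noteq> 0 \<Longrightarrow> degree b < degree f"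
proof -
  define m n where "m = degree f" and "n = degree g"
  define S where "S = sylvester_mat f g"
  have S: "S \<in> carrier_mat (m + n) (m + n)" unfolding S_def m_def n_def by (rule sylvester_carrier_mat)
  have "det (transpose_mat S) = 0" using assms det_transpose[OF S] unfolding resultant_def S_def by simp
  then obtain v where v: "v \<in> carrier_vec (m + n)" "v \<noteq> 0\<^sub>v (m + n)" "transpose_mat S *\<^sub>v v = 0\<^sub>v (m + n)"
    using det_0_iff_vec_prod_zero[of "transpose_mat S" "m + n"] S by auto
  \<comment> \<open>Row i < n stands for t ^ (n - 1 - i) f, so the i-th entry of v is the
    coefficient of t ^ (n - 1 - i) in a; the last m entries give b in the same way.\<close>
  define a b where "a = (\<Sum>i<n. monom (v $ i) (n - 1 - i))" and "b = (\<Sum>i\<in>{n..<m+n}. monom (v $ i) (m + n - 1 - i))"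
  have rel: "(\<Sum>i<m+n. v $ i * S $$ (i, j)) = 0" if "j < m + n" for j
  proof -
    have "0 = (transpose_mat S *\<^sub>v v) $ j" using that v(3) by simp
    also have "\<dots> = (\<Sum>i<m+n. v $ i * S $$ (i, j))"
      using that S v(1) by (auto simp: scalar_prod_def mult.commute atLeast0LessThan intro!: sum.cong)
    finally show ?thesis by simp
  qed
  have co: "coeff (a * f + b * g) l = (\<Sum>i<n. v $ i * coeff (monom 1 (n - 1 - i) * f) l)
     + (\<Sum>i\<in>{n..<m+n}. v $ i * coeff (monom 1 (m + n - 1 - i) * g) l)" for l
    unfolding a_def b_def coeff_add sum_distrib_right coeff_sum
    by (intro arg_cong2[of _ _ _ _ "(+)"] sum.cong refl) (simp_all add: coeff_monom_mult)
  have da: "degree a < n" if "n > 0"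
  proof -
    have "degree a \<le> n - 1" unfolding a_def
      by (rule degree_sum_le) (auto intro: order.trans[OF degree_monom_le])
    thus ?thesis using that by simp
  qed
  have db: "degree b < m" if "m > 0"
  proof -
    have "degree b \<le> m - 1" unfolding b_def
      by (rule degree_sum_le) (auto intro: order.trans[OF degree_monom_le])
    thus ?thesis using that by simp
  qed
  have a0: "a = 0" if "n = 0" using that by (simp add: a_def)
  have b0: "b = 0" if "m = 0" using that by (simp add: b_def)
  have "a * f + b * g = 0"
  proof (rule poly_eqI)
    fix l
    show "coeff (a * f + b * g) l = coeff 0 l"
    proof (cases "l < m + n")
      case True
      define j where "j = m + n - 1 - l"
      have j: "j < m + n" "m + n - 1 - j = l" using True by (auto simp: j_def)
      have S_entry: "S $$ (i, j) = coeff (if i < n then monom 1 (n - 1 - i) * f else monom 1 (m + n - 1 - i) * g) l"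
        if "i < m + n" for i
        unfolding S_def using sylvester_mat_index_shift[of i f g j, folded m_def n_def] that j by simp
      have "coeff (a * f + b * g) l = (\<Sum>i<n. v $ i * S $$ (i, j)) + (\<Sum>i\<in>{n..<m+n}. v $ i * S $$ (i, j))"
        unfolding co
        by (intro arg_cong2[of _ _ _ _ "(+)"] sum.cong refl) (simp_all add: S_entry)
      also have "\<dots> = (\<Sum>i\<in>{..<n} \<union> {n..<m+n}. v $ i * S $$ (i, j))"
        by (rule sum.union_disjoint[symmetric]) auto
      also have "{..<n} \<union> {n..<m+n} = {..<m+n}" by auto
      finally show ?thesis using rel[OF j(1)] by simp
    next
      case False
      have "coeff (a * f) l = 0"
      proof (cases "n = 0")
        case True
        thus ?thesis using a0 by simp
      next
        case False
        hence "degree (a * f) < m + n" using degree_mult_le[of a f] da by (simp add: m_def)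
        thus ?thesis using \<open>\<not> l < m + n\<close> by (intro coeff_eq_0) simp
      qed
      moreover have "coeff (b * g) l = 0"
      proof (cases "m = 0")
        case True
        thus ?thesis using b0 by simp
      next
        case False
        hence "degree (b * g) < m + n" using degree_mult_le[of b g] db by (simp add: n_def)
        thus ?thesis using \<open>\<not> l < m + n\<close> by (intro coeff_eq_0) simp
      qed
      ultimately show ?thesis by simp
    qed
  qed
  moreover have "a \<noteq> 0 \<or> b \<noteq> 0"
  proof (rule ccontr)
    assume "\<not> (a \<noteq> 0 \<or> b \<noteq> 0)"
    hence ab: "a = 0" "b = 0" by auto
    have "v $ i = 0" if i: "i < m + n" for i
    proof (cases "i < n")
      case True
      have "coeff a (n - 1 - i) = (\<Sum>k<n. if k = i then v $ k else 0)"
        unfolding a_def coeff_sum using True by (intro sum.cong) auto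
      thus ?thesis using ab True by simp
    next
      case False
      have "coeff b (m + n - 1 - i) = (\<Sum>k\<in>{n..<m+n}. if k = i then v $ k else 0)"
        unfolding b_def coeff_sum using i False by (intro sum.cong) auto
      thus ?thesis using ab i False by simp
    qed
    hence "v = 0\<^sub>v (m + n)" using v(1) by (intro eq_vecI) auto
    thus False using v(2) by simp
  qed
  moreover have "degree a < degree g" if "a \<noteq> 0" using da a0 that by (cases "n = 0") (auto simp: n_def)
  moreover have "degree b < degree f" if "b \<noteq> 0" using db b0 that by (cases "m = 0") (auto simp: m_def)
  ultimately show ?thesis using that by metis
qed

text \<open>In b g = - a f the prime f divides b or g; but b is nonzero and of smaller degree than
  f.\<close>

lemma resultant_eq_0_imp_dvd:
  fixes f g :: "'a :: idom poly"
  assumes "resultant f g = 0" "prime_elem f"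
  shows "f dvd g"
proof -
  obtain a b where ab: "a * f + b * g = 0" "a \<noteq> 0 \<or> b \<noteq> 0" "b \<noteq> 0 \<Longrightarrow> degree b < degree f"
    using resultant_eq_0_imp_relation[OF assms(1)] by metis
  have "b * g = f * (- a)" using ab(1) by (simp add: eq_neg_iff_add_eq_0 mult.commute add.commute)
  hence "f dvd b * g" by (metis dvd_triv_left)
  hence "f dvd b \<or> f dvd g" using assms(2) by (simp add: prime_elem_dvd_mult_iff)
  moreover have "b \<noteq> 0"
    using ab(1,2) assms(2) by (auto simp: prime_elem_def)
  hence "\<not> f dvd b" using ab(3) dvd_imp_degree_le[of f b] by auto
  ultimately show ?thesis by blast
qed

lemma common_root_imp_resultant_eq_0:
  fixes f g :: "complex poly"
  assumes "poly f t = 0" "poly g t = 0" "degree f > 0"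
  shows "resultant f g = 0"
proof -
  define N where "N = degree f + degree g"
  define v where "v = vec N (\<lambda>j. t ^ (N - 1 - j))"
  have S: "sylvester_mat f g \<in> carrier_mat N N" unfolding N_def by (rule sylvester_carrier_mat)
  have "N > 0" using assms(3) by (simp add: N_def)
  \<comment> \<open>The last entry is t ^ 0, which is 1 even for t = 0.\<close>
  hence "v $ (N - 1) = 1" by (simp add: v_def)
  hence "v \<noteq> 0\<^sub>v N" using \<open>N > 0\<close> by auto
  moreover have "sylvester_mat f g *\<^sub>v v = 0\<^sub>v N"
  proof (rule eq_vecI)
    fix i assume "i < dim_vec (0\<^sub>v N :: complex vec)"
    hence i: "i < N" by simp
    have "(sylvester_mat f g *\<^sub>v v) $ i = (\<Sum>j<N. sylvester_mat f g $$ (i, j) * t ^ (N - 1 - j))"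
      using i S by (auto simp: scalar_prod_def v_def atLeast0LessThan intro!: sum.cong)
    thus "(sylvester_mat f g *\<^sub>v v) $ i = 0\<^sub>v N $ i"
      using sylvester_mat_power_vector[of i f g t] i assms(1,2) unfolding N_def by auto
  qed (use S in auto)
  moreover have "v \<in> carrier_vec N" by (simp add: v_def)
  ultimately show ?thesis
    unfolding resultant_def det_0_iff_vec_prod_zero[OF S] by blast
qed

text \<open>By the fundamental theorem of algebra, f and g without a common root are coprime; then f
  would divide the nonzero cofactor b of smaller degree.\<close>

lemma resultant_eq_0_imp_common_root:
  fixes f g :: "complex poly"
  assumes "resultant f g = 0" "f \<noteq> 0" "g \<noteq> 0"
  obtains t where "poly f t = 0" "poly g t = 0"
proof -
  have "\<exists>t. poly f t = 0 \<and> poly g t = 0"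
  proof (rule ccontr)
    assume no: "\<nexists>t. poly f t = 0 \<and> poly g t = 0"
    have "coprime f g"
    proof (rule coprimeI)
      fix h assume h: "h dvd f" "h dvd g"
      have "constant (poly h)"
      proof (rule ccontr)
        assume "\<not> constant (poly h)"
        then obtain t where "poly h t = 0" using fundamental_theorem_of_algebra by blast
        thus False using no h by (metis dvd_trans poly_eq_0_iff_dvd)
      qed
      hence "degree h = 0" by (simp add: constant_degree)
      thus "is_unit h" using h assms(2) by (metis dvd_0_left is_unit_iff_degree)
    qed
    obtain a b where ab: "a * f + b * g = 0" "a \<noteq> 0 \<or> b \<noteq> 0" "b \<noteq> 0 \<Longrightarrow> degree b < degree f"
      using resultant_eq_0_imp_relation[OF assms(1)] by metis
    have "b * g = f * (- a)" using ab(1) by (simp add: eq_neg_iff_add_eq_0 mult.commute add.commute)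
    hence "f dvd b * g" by (metis dvd_triv_left)
    hence "f dvd b" using coprime_dvd_mult_left_iff[OF \<open>coprime f g\<close>] by blast
    moreover have "b \<noteq> 0" using ab(1,2) assms(2) by auto
    ultimately show False using ab(3) dvd_imp_degree_le[of f b] by auto
  qed
  thus ?thesis using that by blast
qed

text \<open>A nonzero entry in row i and column j has degree at most j - i in the rows of f and at
  most j - (i - n) in the rows of g. Along a permutation the column indices sum to the sum of all
  indices, and subtracting the row weights leaves m * n.\<close>

lemma degree_resultant_le:
  fixes f g :: "'a :: idom poly poly"
  assumes f: "\<And>i. coeff f i \<noteq> 0 \<Longrightarrow> degree (coeff f i) + i \<le> degree f"
    and g: "\<And>i. coeff g i \<noteq> 0 \<Longrightarrow> degree (coeff g i) + i \<le> degree g"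
  shows "degree (resultant f g) \<le> degree f * degree g"
proof -
  define m n where "m = degree f" and "n = degree g"
  define S where "S = sylvester_mat f g"
  have S: "S \<in> carrier_mat (m + n) (m + n)" unfolding S_def m_def n_def by (rule sylvester_carrier_mat)
  have term_le: "degree (\<Prod>i = 0..<m+n. S $$ (i, p i)) \<le> m * n" if p: "p permutes {0..<m+n}" for p
  proof (cases "\<exists>i\<in>{0..<m+n}. S $$ (i, p i) = 0")
    case True
    hence "(\<Prod>i = 0..<m+n. S $$ (i, p i)) = 0" by (intro prod_zero) auto
    thus ?thesis by (simp only: degree_0)
  next
    case False
    define w where "w i = (if i < n then i else i - n)" for i
    have entry: "degree (S $$ (i, p i)) + w i \<le> p i" if i: "i \<in> {0..<m+n}" for i
    proof -
      have pi: "p i < m + n" using permutes_in_image[OF p, of i] i by auto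
      have nz: "S $$ (i, p i) \<noteq> 0" using False i by auto
      have eq: "S $$ (i, p i) =
        (if i < n then
           if i \<le> p i \<and> p i - i \<le> m then coeff f (m + i - p i) else 0
         else if i - n \<le> p i \<and> p i \<le> i then coeff g (i - p i) else 0)"
        unfolding S_def m_def n_def by (rule sylvester_index_mat) (use i pi in \<open>auto simp: m_def n_def\<close>)
      show ?thesis
      proof (cases "i < n")
        case True
        hence "i \<le> p i" "p i - i \<le> m" "S $$ (i, p i) = coeff f (m + i - p i)"
          using nz eq by (auto split: if_splits)
        thus ?thesis using f[of "m + i - p i"] nz True unfolding w_def m_def[symmetric] by auto
      next
        case False
        hence "i - n \<le> p i" "p i \<le> i" "S $$ (i, p i) = coeff g (i - p i)"
          using nz eq by (auto split: if_splits)
        thus ?thesis using g[of "i - p i"] nz False unfolding w_def n_def[symmetric] by auto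
      qed
    qed
    have union: "{0..<m+n} = {0..<n} \<union> {n..<m+n}" by auto
    have shift: "(\<Sum>i\<in>{n..<m+n}. h i) = (\<Sum>i\<in>{0..<m}. h (i + n))" for h :: "nat \<Rightarrow> nat"
      using sum.shift_bounds_nat_ivl[of h 0 n m] by simp
    have "degree (\<Prod>i = 0..<m+n. S $$ (i, p i)) + (\<Sum>i = 0..<m+n. w i) \<le>
        (\<Sum>i = 0..<m+n. degree (S $$ (i, p i)) + w i)"
      using degree_prod_sum_le[of "{0..<m+n}" "\<lambda>i. S $$ (i, p i)"] by (simp add: sum.distrib)
    also have "\<dots> \<le> (\<Sum>i = 0..<m+n. p i)" by (rule sum_mono) (rule entry)
    also have "\<dots> = (\<Sum>i = 0..<m+n. i)" using sum.permute[OF p, of "\<lambda>i. i"] by (simp add: comp_def)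
    also have "\<dots> = (\<Sum>i = 0..<n. i) + (\<Sum>i = 0..<m. i) + m * n"
      unfolding union by (subst sum.union_disjoint) (auto simp: shift sum.distrib)
    also have "(\<Sum>i = 0..<m+n. w i) = (\<Sum>i = 0..<n. i) + (\<Sum>i = 0..<m. i)"
      unfolding union by (subst sum.union_disjoint) (auto simp: shift w_def)
    finally show ?thesis by simp
  qed
  have "degree (of_int (sign p) * (\<Prod>i = 0..<m+n. S $$ (i, p i))) \<le> m * n" if "p permutes {0..<m+n}" for p
    using term_le[OF that] by (auto simp: sign_def)
  hence "degree (det S) \<le> m * n"
    unfolding det_def'[OF S] by (intro degree_sum_le) (auto simp: finite_permutations)
  thus ?thesis unfolding resultant_def S_def m_def n_def .
qed

text \<open>A kernel vector of the transpose would be a nonzero polynomial of degree below N with N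
  distinct roots.\<close>

lemma det_vandermonde_nonzero:
  fixes ts :: "'a :: idom list"
  assumes "distinct ts" "length ts = N"
  shows "det (Matrix.mat N N (\<lambda>(j, l). (ts ! l) ^ (N - 1 - j))) \<noteq> 0"
proof
  let ?V = "Matrix.mat N N (\<lambda>(j, l). (ts ! l) ^ (N - 1 - j))"
  assume "det ?V = 0"
  hence "det (transpose_mat ?V) = 0" by (subst det_transpose) auto
  then obtain v where v: "v \<in> carrier_vec N" "v \<noteq> 0\<^sub>v N" "transpose_mat ?V *\<^sub>v v = 0\<^sub>v N"
    using det_0_iff_vec_prod_zero[of "transpose_mat ?V" N] by auto
  define p where "p = (\<Sum>j<N. monom (v $ j) (N - 1 - j))"
  have root: "poly p (ts ! l) = 0" if "l < N" for l
  proof -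
    have "0 = (transpose_mat ?V *\<^sub>v v) $ l" using v(3) that by simp
    also have "\<dots> = poly p (ts ! l)"
      using that v(1) unfolding p_def poly_sum
      by (auto simp: scalar_prod_def poly_monom mult.commute atLeast0LessThan intro!: sum.cong)
    finally show ?thesis by simp
  qed
  have co: "coeff p (N - 1 - i) = v $ i" if "i < N" for i
  proof -
    have "coeff p (N - 1 - i) = (\<Sum>k<N. if k = i then v $ k else 0)"
      unfolding p_def coeff_sum using that by (intro sum.cong) auto
    thus ?thesis using that by simp
  qed
  have "p \<noteq> 0"
  proof
    assume "p = 0"
    hence "v = 0\<^sub>v N" using v(1) co by (intro eq_vecI) auto
    thus False using v(2) by simp
  qed
  have "N > 0" using v(1,2) by (cases N) auto
  have "degree p \<le> N - 1" unfolding p_def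
    by (rule degree_sum_le) (auto intro: order.trans[OF degree_monom_le])
  moreover have "N \<le> degree p"
  proof -
    have "set ts \<subseteq> {x. poly p x = 0}" using root assms by (auto simp: in_set_conv_nth)
    hence "card (set ts) \<le> card {x. poly p x = 0}"
      using poly_roots_finite[OF \<open>p \<noteq> 0\<close>] by (rule card_mono[rotated])
    also have "\<dots> \<le> degree p" by (rule card_poly_roots_bound[OF \<open>p \<noteq> 0\<close>])
    finally show ?thesis using assms distinct_card by metis
  qed
  ultimately show False using \<open>N > 0\<close> by simp
qed

text \<open>Multiplying the Sylvester matrix by a Vandermonde matrix whose first nodes are the elements of
  \<open>T\<close> makes the corresponding columns divisible by \<open>X - a\<close>.\<close>
lemma power_dvd_resultant:
  fixes f g :: "complex poly poly"
  assumes T: "finite T" "card T \<le> degree f + degree g"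
    and roots: "\<And>t. t \<in> T \<Longrightarrow> poly (poly f [:t:]) a = 0" "\<And>t. t \<in> T \<Longrightarrow> poly (poly g [:t:]) a = 0"
  shows "[:- a, 1:] ^ card T dvd resultant f g"
proof -
  define N where "N = degree f + degree g"
  \<comment> \<open>Padding T to N distinct nodes makes the Vandermonde matrix square and
    invertible. Its entries are constants, so its determinant is a unit and can be cancelled from
    the final divisibility.\<close>
  obtain U where U: "finite U" "card U = N - card T" "U \<inter> T = {}"
  proof -
    have "infinite (- T)" using T(1) infinite_UNIV_char_0[where 'a=complex] by (metis finite_compl)
    then obtain U where "finite U" "card U = N - card T" "U \<subseteq> - T"
      using infinite_arbitrarily_large by blast
    thus ?thesis using that by blast
  qed
  obtain us where us: "set us = U" "distinct us" using finite_distinct_list[OF U(1)] by blast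
  obtain ts0 where ts0: "set ts0 = T" "distinct ts0" using finite_distinct_list[OF T(1)] by blast
  define ts where "ts = ts0 @ us"
  have len0: "length ts0 = card T" using ts0 distinct_card by fastforce
  have "length us = N - card T" using us U(2) distinct_card by fastforce
  hence ts: "distinct ts" "length ts = N" using ts0 us U(3) T(2) len0 by (auto simp: ts_def N_def)
  have ts_T: "ts ! l \<in> T" if "l < card T" for l
    using that len0 ts0(1) by (auto simp: ts_def nth_append)
  define V0 where "V0 = Matrix.mat N N (\<lambda>(j, l). (ts ! l) ^ (N - 1 - j))"
  define V where "V = map_mat (\<lambda>z. [:z:]) V0"
  define S where "S = sylvester_mat f g"
  have S: "S \<in> carrier_mat N N" unfolding S_def N_def by (rule sylvester_carrier_mat)
  have V: "V \<in> carrier_mat N N" unfolding V_def V0_def by simp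
  have detV: "det V = [:det V0:]"
  proof -
    interpret comm_ring_hom "\<lambda>z :: complex. [:z:]" by unfold_locales (auto simp: one_pCons)
    show ?thesis unfolding V_def by (simp add: hom_det)
  qed
  have "det V0 \<noteq> 0" unfolding V0_def by (rule det_vandermonde_nonzero[OF ts])
  hence unit: "is_unit (det V)" unfolding detV by (simp add: is_unit_const_poly_iff)
  have entry: "[:- a, 1:] dvd (S * V) $$ (i, l)" if il: "i < N" "l < card T" for i l
  proof -
    have l: "l < N" using il T(2) by (simp add: N_def)
    have "(S * V) $$ (i, l) = (\<Sum>j<N. S $$ (i, j) * [:ts ! l:] ^ (N - 1 - j))"
      using il l S by (auto simp: V_def V0_def scalar_prod_def atLeast0LessThan poly_const_pow intro!: sum.cong)
    also have "\<dots> = (if i < degree g then [:ts ! l:] ^ (degree g - 1 - i) * poly f [:ts ! l:]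
        else [:ts ! l:] ^ (N - 1 - i) * poly g [:ts ! l:])"
      unfolding S_def N_def by (rule sylvester_mat_power_vector) (use il in \<open>simp add: N_def\<close>)
    finally show ?thesis
      using roots[OF ts_T[OF il(2)]] by (auto simp: poly_eq_0_iff_dvd intro: dvd_mult)
  qed
  have "[:- a, 1:] ^ card T dvd (\<Prod>j<N. (S * V) $$ (p j, j))" if p: "p permutes {0..<N}" for p
  proof -
    have "(\<Prod>j<card T. [:- a, 1:]) dvd (\<Prod>j<card T. (S * V) $$ (p j, j))"
    proof (rule prod_dvd_prod)
      fix j assume j: "j \<in> {..<card T}"
      have "p j < N" using permutes_in_image[OF p, of j] j T(2) by (auto simp: N_def)
      thus "[:- a, 1:] dvd (S * V) $$ (p j, j)" using entry j by auto
    qed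
    also have "(\<Prod>j<card T. (S * V) $$ (p j, j)) dvd (\<Prod>j<N. (S * V) $$ (p j, j))"
      by (rule prod_dvd_prod_subset) (use T(2) in \<open>auto simp: N_def\<close>)
    finally show ?thesis by simp
  qed
  hence "[:- a, 1:] ^ card T dvd det (S * V)"
    unfolding det_col[OF mult_carrier_mat[OF S V]] by (intro dvd_sum dvd_mult) auto
  hence "[:- a, 1:] ^ card T dvd det S * det V" using det_mult[OF S V] by simp
  thus ?thesis using unit unfolding resultant_def S_def by (simp add: dvd_mult_unit_iff)
qed

lemma poly_poly_const: "poly (poly f [:t:]) x = poly (map_poly (\<lambda>p. poly p x) f) t"
  by (induction f) (simp_all add: map_poly_pCons)

text \<open>The points above one x number at most the multiplicity of x as a root of a nonzero
  resultant, and these multiplicities add up to at most its degree.\<close>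

lemma bezout_affine:
  fixes f g :: "complex poly poly"
  assumes f: "\<And>i. coeff f i \<noteq> 0 \<Longrightarrow> degree (coeff f i) + i \<le> degree f" "lead_coeff f = 1"
    and g: "\<And>i. coeff g i \<noteq> 0 \<Longrightarrow> degree (coeff g i) + i \<le> degree g"
    and P: "finite P" "card P > degree f * degree g"
    and roots: "\<And>x t. (x, t) \<in> P \<Longrightarrow> poly (poly f [:t:]) x = 0 \<and> poly (poly g [:t:]) x = 0"
  shows "resultant f g = 0"
proof (rule ccontr)
  assume nz: "resultant f g \<noteq> 0"
  have le: "card (P `` {x}) \<le> count (proots (resultant f g)) x" for x
  proof -
    have fin: "finite (P `` {x})" using P(1) by auto
    define h where "h = map_poly (\<lambda>p. poly p x) f"
    \<comment> \<open>Since f is monic in t, its specialization at x is nonzero. This limits the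
      points above x to \<open>degree f\<close>, within the bound that
      \<open>power_dvd_resultant\<close> requires.\<close>
    have "coeff h (degree f) = 1" unfolding h_def using f(2) by simp
    hence h: "h \<noteq> 0" by auto
    have "degree h \<le> degree f" unfolding h_def by (rule degree_map_poly_le)
    have "poly h t = poly (poly f [:t:]) x" for t
      unfolding h_def by (rule poly_poly_const[symmetric])
    hence "P `` {x} \<subseteq> {t. poly h t = 0}" using roots by auto
    hence "card (P `` {x}) \<le> card {t. poly h t = 0}"
      using poly_roots_finite[OF h] by (rule card_mono[rotated])
    also have "\<dots> \<le> degree h" by (rule card_poly_roots_bound[OF h])
    finally have "card (P `` {x}) \<le> degree f + degree g" using \<open>degree h \<le> degree f\<close> by simp
    hence "[:- x, 1:] ^ card (P `` {x}) dvd resultant f g"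
      using roots by (intro power_dvd_resultant fin) auto
    thus ?thesis using nz by (simp add: order_divides)
  qed
  have "card P = (\<Sum>x\<in>fst ` P. card (P `` {x}))"
  proof -
    have "P = (SIGMA x:fst ` P. P `` {x})" by force
    hence "card P = card (SIGMA x:fst ` P. P `` {x})" by (rule arg_cong)
    also have "\<dots> = (\<Sum>x\<in>fst ` P. card (P `` {x}))" using P(1) by (intro card_SigmaI) auto
    finally show ?thesis .
  qed
  also have "\<dots> \<le> (\<Sum>x\<in>fst ` P. count (proots (resultant f g)) x)" by (rule sum_mono) (rule le)
  also have "\<dots> \<le> (\<Sum>x\<in>fst ` P \<union> set_mset (proots (resultant f g)). count (proots (resultant f g)) x)"
    by (rule sum_mono2) (use P(1) in auto)
  also have "\<dots> = size (proots (resultant f g))"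
    unfolding size_multiset_overloaded_eq
    by (rule sum.mono_neutral_right) (use P(1) in \<open>auto simp: not_in_iff simp del: count_proots set_count_proots\<close>)
  also have "\<dots> \<le> degree f * degree g"
    using size_proots_le[of "resultant f g"] degree_resultant_le[OF f(1) g] by simp
  finally show False using P(2) by simp
qed

section \<open>Unitary triangularization\<close>

lemma mat_adjoint_mult:
  assumes A: "A \<in> carrier_mat n m" and B: "B \<in> carrier_mat m k"
  shows "mat_adjoint (A * B :: complex mat) = mat_adjoint B * mat_adjoint A"
proof (rule eq_matI)
  have AB: "A * B \<in> carrier_mat n k" using A B by simp
  note car = mat_adjoint_carrier[OF AB] mat_adjoint_carrier[OF A] mat_adjoint_carrier[OF B]
  fix i j assume "i < dim_row (mat_adjoint B * mat_adjoint A)" "j < dim_col (mat_adjoint B * mat_adjoint A)"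
  hence ij: "i < k" "j < n" using car by auto
  show "mat_adjoint (A * B) $$ (i, j) = (mat_adjoint B * mat_adjoint A) $$ (i, j)"
    using A B ij car
    by (simp add: mat_adjoint_index[OF AB] scalar_prod_def mat_adjoint_index[OF A] mat_adjoint_index[OF B] mult.commute)
qed (use A B mat_adjoint_carrier[OF A] mat_adjoint_carrier[OF B] mat_adjoint_carrier[of "A * B" n k] in auto)

lemma mat_adjoint_mat_adjoint:
  assumes A: "A \<in> carrier_mat n m"
  shows "mat_adjoint (mat_adjoint (A :: complex mat)) = A"
  by (rule eq_matI)
    (use A mat_adjoint_carrier[OF A] mat_adjoint_carrier[OF mat_adjoint_carrier[OF A]] in
      \<open>auto simp: mat_adjoint_index[OF mat_adjoint_carrier[OF A]] mat_adjoint_index[OF A]\<close>)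

text \<open>Gram-Schmidt applied to a basis starting with v keeps v in front; dividing each vector
  by its length makes the orthogonal system orthonormal.\<close>

lemma ex_unitary_first_col:
  fixes v :: "complex vec"
  assumes v: "v \<in> carrier_vec n" "v \<noteq> 0\<^sub>v n" and n: "n > 0"
  obtains W s where "W \<in> carrier_mat n n" "mat_adjoint W * W = 1\<^sub>m n" "col W 0 = s \<cdot>\<^sub>v v"
proof -
  interpret cof_vec_space n "TYPE(complex)" .
  define b where "b = basis_completion v"
  note b = basis_completion[OF v, folded b_def]
  define ws where "ws = gram_schmidt n b"
  have ws: "set ws \<subseteq> carrier_vec n" "corthogonal ws" "length ws = n"
    using gram_schmidt_result[OF b(2,4,5) refl, folded ws_def] b(6) by auto
  have "b = v # tl b" using b(6,7) n by (cases b) auto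
  hence "hd ws = v" using gram_schmidt_hd[OF v(1), of "tl b"] unfolding ws_def by simp
  hence ws0: "ws ! 0 = v" using ws(3) n by (cases ws) auto
  define N where "N i = (\<Sum>k<n. (cmod (ws ! i $ k))\<^sup>2)" for i
  define W where "W = Matrix.mat n n (\<lambda>(k, i). ws ! i $ k / of_real (sqrt (N i)))"
  have W: "W \<in> carrier_mat n n" by (simp add: W_def)
  have wsc: "ws ! i \<in> carrier_vec n" if "i < n" for i using ws(1,3) that by auto
  have inner: "(ws ! j) \<bullet>c (ws ! i) = (\<Sum>k<n. cnj (ws ! i $ k) * ws ! j $ k)" if "i < n" "j < n" for i j
    using wsc[OF that(1)] wsc[OF that(2)]
    by (auto simp: scalar_prod_def atLeast0LessThan mult.commute intro!: sum.cong)
  have NN: "of_real (N i) = (\<Sum>k<n. cnj (ws ! i $ k) * ws ! i $ k)" for i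
    unfolding N_def of_real_sum by (simp add: complex_norm_square mult.commute del: of_real_power)
  have N: "N i > 0" if "i < n" for i
  proof -
    have "(ws ! i) \<bullet>c (ws ! i) \<noteq> 0" using corthogonalD[OF ws(2), of i i] that ws(3) by simp
    hence "N i \<noteq> 0" using inner[OF that that] NN[of i] by auto
    moreover have "N i \<ge> 0" unfolding N_def by (intro sum_nonneg) auto
    ultimately show ?thesis by simp
  qed
  have "mat_adjoint W * W = 1\<^sub>m n"
  proof (rule eq_matI)
    fix i j assume "i < dim_row (1\<^sub>m n :: complex mat)" "j < dim_col (1\<^sub>m n :: complex mat)"
    hence ij: "i < n" "j < n" by auto
    have "(mat_adjoint W * W) $$ (i, j) = (\<Sum>k<n. cnj (W $$ (k, i)) * W $$ (k, j))"
      using ij W mat_adjoint_carrier[OF W]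
      by (auto simp: scalar_prod_def atLeast0LessThan mat_adjoint_index[OF W])
    also have "\<dots> = (\<Sum>k<n. cnj (ws ! i $ k) * ws ! j $ k) / (of_real (sqrt (N i)) * of_real (sqrt (N j)))"
      using ij unfolding W_def by (simp add: sum_divide_distrib)
    also have "\<dots> = (1\<^sub>m n) $$ (i, j)"
    proof (cases "i = j")
      case True
      have "of_real (sqrt (N j)) * of_real (sqrt (N j)) = (of_real (N j) :: complex)"
        using N[OF ij(2)] by (simp flip: of_real_mult)
      thus ?thesis using True ij N[OF ij(2)] NN[of j] by auto
    next
      case False
      thus ?thesis using inner[OF ij] corthogonalD[OF ws(2), of j i] ij ws(3) by simp
    qed
    finally show "(mat_adjoint W * W) $$ (i, j) = (1\<^sub>m n) $$ (i, j)" .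
  qed (use W mat_adjoint_carrier[OF W] in auto)
  moreover have "col W 0 = (1 / of_real (sqrt (N 0))) \<cdot>\<^sub>v v"
    by (rule eq_vecI) (use n v W in \<open>auto simp: W_def ws0\<close>)
  ultimately show ?thesis using that W by blast
qed

text \<open>Schur triangularization by splitting off one eigenvector at a time, in the order
  prescribed by \<open>es\<close>; the order matters because weights are matched with eigenvalues by
  position. Only the diagonal is recorded: its entries are the quadratic forms of A at the columns
  of U.\<close>

lemma unitary_schur_diagonal:
  fixes A :: "complex mat"
  assumes "A \<in> carrier_mat n n" "char_poly A = (\<Prod>e\<leftarrow>es. [:- e, 1:])"
  shows "\<exists>U\<in>carrier_mat n n. mat_adjoint U * U = 1\<^sub>m n \<and> (\<forall>j<n. (mat_adjoint U * A * U) $$ (j, j) = es ! j)"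
  using assms
proof (induction es arbitrary: n A)
  case Nil
  hence "n = 0" using degree_monic_char_poly[of A n] by simp
  thus ?case by (intro bexI[of _ "1\<^sub>m 0"]) (auto intro!: eq_matI simp: mat_adjoint_def)
next
  case (Cons e es)
  have A: "A \<in> carrier_mat n n" by fact
  have "degree (char_poly A) \<noteq> 0"
  proof -
    have "(\<Prod>e\<leftarrow>es. [:- e, 1:]) \<noteq> 0" by (auto simp: prod_list_zero_iff)
    thus ?thesis unfolding Cons.prems(2) by (simp add: degree_mult_eq del: mult_pCons_left)
  qed
  then obtain m where n: "n = Suc m" using degree_monic_char_poly[OF A] by (cases n) auto
  have "eigenvalue A e" unfolding eigenvalue_root_char_poly[OF A] Cons.prems(2) by simp
  then obtain v where v: "v \<in> carrier_vec n" "v \<noteq> 0\<^sub>v n" "A *\<^sub>v v = e \<cdot>\<^sub>v v"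
    using A unfolding eigenvalue_def eigenvector_def by auto
  obtain W s where W: "W \<in> carrier_mat n n" "mat_adjoint W * W = 1\<^sub>m n" "col W 0 = s \<cdot>\<^sub>v v"
    using ex_unitary_first_col[OF v(1,2)] n by auto
  note W' = mat_adjoint_carrier[OF W(1)]
  define A' where "A' = mat_adjoint W * A * W"
  have A': "A' \<in> carrier_mat n n" using A W W' by (simp add: A'_def)
  have "W * mat_adjoint W = 1\<^sub>m n" by (rule mat_mult_left_right_inverse[OF W' W(1,2)])
  hence "similar_mat_wit A' A (mat_adjoint W) W"
    by (intro similar_mat_witI[of _ _ n]) (use W W' A A' in \<open>auto simp: A'_def\<close>)
  hence cp: "char_poly A' = char_poly A" using char_poly_similar unfolding similar_mat_def by blast
  have col0: "A' $$ (i, 0) = (if i = 0 then e else 0)" if "i < n" for i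
  proof -
    have "A' = mat_adjoint W * (A * W)" unfolding A'_def using W' A W(1) by (rule assoc_mult_mat)
    hence "A' $$ (i, 0) = row (mat_adjoint W) i \<bullet> col (A * W) 0"
      using that n W' A W(1) by simp
    also have "col (A * W) 0 = A *\<^sub>v col W 0" using n A W(1) by (intro col_mult2) auto
    also have "\<dots> = e \<cdot>\<^sub>v col W 0"
      unfolding W(3) using v A by (simp add: mult_mat_vec smult_smult_assoc mult.commute)
    also have "row (mat_adjoint W) i \<bullet> (e \<cdot>\<^sub>v col W 0) = e * (mat_adjoint W * W) $$ (i, 0)"
      using that n W(1) W' by simp
    finally show ?thesis unfolding W(2) using that n by simp
  qed
  define A1 A2 A3 where "A1 = Matrix.mat 1 1 (\<lambda>_. e)" and "A2 = Matrix.mat 1 m (\<lambda>(i, j). A' $$ (0, Suc j))"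
    and "A3 = Matrix.mat m m (\<lambda>(i, j). A' $$ (Suc i, Suc j))"
  have c: "A1 \<in> carrier_mat 1 1" "A2 \<in> carrier_mat 1 m" "A3 \<in> carrier_mat m m"
    by (auto simp: A1_def A2_def A3_def)
  have block: "A' = four_block_mat A1 A2 (0\<^sub>m m 1) A3"
    by (rule eq_matI)
      (use A' n col0 in \<open>auto simp: A1_def A2_def A3_def not_less less_Suc_eq_0_disj split: nat.splits\<close>)
  have "char_poly A1 = [:- e, 1:]" by (simp add: A1_def char_poly_defs det_def sign_def)
  hence "[:- e, 1:] * char_poly A3 = [:- e, 1:] * (\<Prod>e\<leftarrow>es. [:- e, 1:])"
    using cp Cons.prems(2) unfolding block char_poly_four_block_zeros_col[OF c] by simp
  hence "char_poly A3 = (\<Prod>e\<leftarrow>es. [:- e, 1:])"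
    by (metis mult_cancel_left pCons_eq_0_iff zero_neq_one)
  from Cons.IH[OF c(3) this] obtain U3 where U3: "U3 \<in> carrier_mat m m" "mat_adjoint U3 * U3 = 1\<^sub>m m"
    "\<And>j. j < m \<Longrightarrow> (mat_adjoint U3 * A3 * U3) $$ (j, j) = es ! j" by blast
  note U3' = mat_adjoint_carrier[OF U3(1)]
  define F where "F = four_block_mat (1\<^sub>m 1) (0\<^sub>m 1 m) (0\<^sub>m m 1) U3"
  have F: "F \<in> carrier_mat n n" using U3(1) n by (auto simp: F_def)
  have F': "mat_adjoint F = four_block_mat (1\<^sub>m 1) (0\<^sub>m 1 m) (0\<^sub>m m 1) (mat_adjoint U3)"
  proof (rule eq_matI)
    let ?G = "four_block_mat (1\<^sub>m 1) (0\<^sub>m 1 m) (0\<^sub>m m 1) (mat_adjoint U3)"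
    fix i j assume "i < dim_row ?G" "j < dim_col ?G"
    hence ij: "i < n" "j < n" using U3' n by auto
    have "mat_adjoint F $$ (i, j) = cnj (F $$ (j, i))" by (rule mat_adjoint_index[OF F ij])
    also have "\<dots> = ?G $$ (i, j)"
      unfolding F_def using ij n U3(1) U3' by (auto simp: mat_adjoint_index[OF U3(1)])
    finally show "mat_adjoint F $$ (i, j) = ?G $$ (i, j)" .
  qed (use mat_adjoint_carrier[OF F] U3' n in auto)
  have F'c: "mat_adjoint F \<in> carrier_mat n n" by (rule mat_adjoint_carrier[OF F])
  have FF: "mat_adjoint F * F = 1\<^sub>m n"
    unfolding F' unfolding F_def
    by (subst mult_four_block_mat[of _ 1 1 _ m _ m _ _ 1 _ m])
       (use U3 U3' n in \<open>auto simp: four_block_one_mat\<close>)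
  have FAF: "mat_adjoint F * A' * F = four_block_mat A1 (A2 * U3) (0\<^sub>m m 1) (mat_adjoint U3 * A3 * U3)"
    unfolding F' block unfolding F_def
    by (subst mult_four_block_mat[of _ 1 1 _ m _ m _ _ 1 _ m],
        (use U3 U3' n c in auto)[8],
        subst mult_four_block_mat[of _ 1 1 _ m _ m _ _ 1 _ m])
       (use U3 U3' n c in auto)
  define U where "U = W * F"
  have U: "U \<in> carrier_mat n n" using W(1) F by (simp add: U_def)
  have U': "mat_adjoint U = mat_adjoint F * mat_adjoint W" unfolding U_def by (rule mat_adjoint_mult[OF W(1) F])
  have "mat_adjoint U * U = mat_adjoint F * ((mat_adjoint W * W) * F)"
    unfolding U' unfolding U_def using W(1) W' F F'c by (simp add: assoc_mult_mat[of _ n n _ n _ n])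
  hence "mat_adjoint U * U = 1\<^sub>m n" unfolding W(2) using F FF by simp
  moreover have "mat_adjoint U * A * U = mat_adjoint F * A' * F"
    unfolding U' A'_def unfolding U_def using A W(1) W' F F'c by (simp add: assoc_mult_mat[of _ n n _ n _ n])
  hence "(mat_adjoint U * A * U) $$ (j, j) = (e # es) ! j" if "j < n" for j
    using that n c U3(1,3) U3' unfolding FAF by (cases j) (auto simp: A1_def)
  ultimately show ?case using U by blast
qed

text \<open>The diagonal of a unitary conjugate of H is real, so the real parts taken in
  \<open>herm_eig\<close> lose nothing. A second triangularization, with the sorted list as
  prescribed order, provides the orthonormal vectors.\<close>

lemma herm_eig_Hermitian:
  assumes H: "H \<in> carrier_mat n n" and herm: "mat_adjoint H = H"
  shows "length (herm_eig H) = n" "mset (map of_real (herm_eig H)) = eig_mset H"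
    and "\<exists>x. (\<forall>j<n. x j \<in> carrier_vec n) \<and>
      (\<forall>j<n. \<forall>k<n. conjugate (x j) \<bullet> x k = (if j = k then 1 else 0)) \<and>
      (\<forall>j<n. conjugate (x j) \<bullet> (H *\<^sub>v x j) = of_real (herm_eig H ! j))"
proof -
  have real: "Im (es ! j) = 0" if "U \<in> carrier_mat n n" "j < n" "(mat_adjoint U * H * U) $$ (j, j) = es ! j" for U es j
  proof -
    note U' = mat_adjoint_carrier[OF that(1)]
    have "mat_adjoint (mat_adjoint U * H * U) = mat_adjoint U * (H * U)"
      using that(1) U' H herm by (simp add: mat_adjoint_mult[of _ n n _ n] mat_adjoint_mat_adjoint[OF that(1)])
    also have "\<dots> = mat_adjoint U * H * U" using that(1) U' H by (simp add: assoc_mult_mat[of _ n n _ n _ n])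
    finally have "cnj ((mat_adjoint U * H * U) $$ (j, j)) = (mat_adjoint U * H * U) $$ (j, j)"
      using mat_adjoint_index[of "mat_adjoint U * H * U" n n j j] that U' H by simp
    thus ?thesis unfolding that(3) by (metis Reals_cnj_iff complex_is_Real_iff)
  qed
  obtain U0 where U0: "U0 \<in> carrier_mat n n" "\<And>j. j < n \<Longrightarrow> (mat_adjoint U0 * H * U0) $$ (j, j) = eig_list H ! j"
    using unitary_schur_diagonal[OF H eig_list(3)[OF H]] by blast
  have "Im a = 0" if "a \<in># eig_mset H" for a
  proof -
    have "a \<in> set (eig_list H)" using that eig_list(1)[OF H] by (metis set_mset_mset)
    then obtain j where "j < n" "a = eig_list H ! j" using eig_list(2)[OF H] by (auto simp: in_set_conv_nth)
    thus ?thesis using real[OF U0(1) _ U0(2)] by auto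
  qed
  hence "image_mset (\<lambda>a. complex_of_real (Re a)) (eig_mset H) = image_mset (\<lambda>a. a) (eig_mset H)"
    by (intro image_mset_cong) (simp add: complex_eq_iff)
  moreover have ms: "mset (herm_eig H) = image_mset Re (eig_mset H)" unfolding herm_eig_def by simp
  ultimately show m: "mset (map of_real (herm_eig H)) = eig_mset H"
    by (simp add: image_mset.compositionality comp_def)
  show len: "length (herm_eig H) = n"
    using arg_cong[OF ms, of size] eig_list(1,2)[OF H] by (metis size_image_mset size_mset)
  have "char_poly H = (\<Prod>a\<in>#eig_mset H. [:- a, 1:])"
    by (metis eig_list(1,3)[OF H] mset_map prod_mset_prod_list)
  also have "\<dots> = (\<Prod>a\<leftarrow>map of_real (herm_eig H). [:- a, 1:])"
    unfolding m[symmetric] by (metis mset_map prod_mset_prod_list)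
  finally obtain U where U: "U \<in> carrier_mat n n" "mat_adjoint U * U = 1\<^sub>m n"
    "\<And>j. j < n \<Longrightarrow> (mat_adjoint U * H * U) $$ (j, j) = map of_real (herm_eig H) ! j"
    using unitary_schur_diagonal[OF H] by blast
  note U' = mat_adjoint_carrier[OF U(1)]
  have row: "row (mat_adjoint U) j = conjugate (col U j)" if "j < n" for j
    by (rule eq_vecI) (use that U(1) U' in \<open>auto simp: mat_adjoint_index[OF U(1)]\<close>)
  have "conjugate (col U j) \<bullet> col U k = (if j = k then 1 else 0)" if "j < n" "k < n" for j k
  proof -
    have "(mat_adjoint U * U) $$ (j, k) = conjugate (col U j) \<bullet> col U k"
      using that U(1) U' by (simp add: row)
    thus ?thesis unfolding U(2) using that by simp
  qed
  moreover have "conjugate (col U j) \<bullet> (H *\<^sub>v col U j) = of_real (herm_eig H ! j)" if "j < n" for j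
  proof -
    have "mat_adjoint U * H * U = mat_adjoint U * (H * U)" using U' H U(1) by (rule assoc_mult_mat)
    hence "(mat_adjoint U * H * U) $$ (j, j) = conjugate (col U j) \<bullet> col (H * U) j"
      using that U(1) U' H by (simp add: row)
    also have "col (H * U) j = H *\<^sub>v col U j" using that H U(1) by (intro col_mult2) auto
    finally show ?thesis using U(3)[OF that] that len by simp
  qed
  ultimately show "\<exists>x. (\<forall>j<n. x j \<in> carrier_vec n) \<and>
      (\<forall>j<n. \<forall>k<n. conjugate (x j) \<bullet> x k = (if j = k then 1 else 0)) \<and>
      (\<forall>j<n. conjugate (x j) \<bullet> (H *\<^sub>v x j) = of_real (herm_eig H ! j))"
    using U(1) by (intro exI[of _ "col U"]) auto
qed

section \<open>Supporting lines of the weighted numerical range\<close>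

lemma H_theta_carrier:
  assumes "A \<in> carrier_mat n n"
  shows "H_theta \<theta> A \<in> carrier_mat n n"
  unfolding H_theta_pencil[OF assms] by (rule pencil_carrier[OF assms])

lemma H_theta_Hermitian:
  assumes A: "A \<in> carrier_mat n n"
  shows "mat_adjoint (H_theta \<theta> A) = H_theta \<theta> A"
proof (rule eq_matI)
  note H = H_theta_carrier[OF A, of \<theta>]
  fix i j assume "i < dim_row (H_theta \<theta> A)" "j < dim_col (H_theta \<theta> A)"
  hence ij: "i < n" "j < n" using H by auto
  have entry: "H_theta \<theta> A $$ (i, j) = cis \<theta> / 2 * A $$ (i, j) + cis (- \<theta>) / 2 * cnj (A $$ (j, i))"
    if "i < n" "j < n" for i j
    unfolding H_theta_pencil[OF A] using that A mat_adjoint_carrier[OF A] by (simp add: mat_adjoint_index[OF A])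
  have "mat_adjoint (H_theta \<theta> A) $$ (i, j) = cnj (H_theta \<theta> A $$ (j, i))"
    by (rule mat_adjoint_index[OF H ij])
  also have "\<dots> = H_theta \<theta> A $$ (i, j)"
    using ij by (simp add: entry cis_cnj add.commute)
  finally show "mat_adjoint (H_theta \<theta> A) $$ (i, j) = H_theta \<theta> A $$ (i, j)" .
qed (use H_theta_carrier[OF A, of \<theta>] mat_adjoint_carrier[OF H_theta_carrier[OF A, of \<theta>]] in auto)

text \<open>The form of A* at x is the conjugate of the form of A, so the average in
  \<open>H_theta\<close> leaves a real part.\<close>

lemma quadratic_form_H_theta:
  assumes A: "A \<in> carrier_mat n n" and x: "x \<in> carrier_vec n"
  shows "conjugate x \<bullet> (H_theta \<theta> A *\<^sub>v x) = of_real (Re (cis \<theta> * (conjugate x \<bullet> (A *\<^sub>v x))))"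
proof -
  have form: "conjugate x \<bullet> (M *\<^sub>v x) = (\<Sum>i<n. \<Sum>j<n. cnj (x $ i) * M $$ (i, j) * x $ j)"
    if "M \<in> carrier_mat n n" for M
    using that x by (auto simp: scalar_prod_def atLeast0LessThan sum_distrib_left mult.assoc intro!: sum.cong)
  define q where "q = conjugate x \<bullet> (A *\<^sub>v x)"
  have "conjugate x \<bullet> (mat_adjoint A *\<^sub>v x) = (\<Sum>i<n. \<Sum>j<n. cnj (x $ i) * cnj (A $$ (j, i)) * x $ j)"
    unfolding form[OF mat_adjoint_carrier[OF A]] by (intro sum.cong) (auto simp: mat_adjoint_index[OF A])
  also have "\<dots> = (\<Sum>j<n. \<Sum>i<n. cnj (x $ i) * cnj (A $$ (j, i)) * x $ j)" by (rule sum.swap)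
  also have "\<dots> = cnj q" unfolding q_def form[OF A] by (simp add: mult_ac)
  finally have q': "conjugate x \<bullet> (mat_adjoint A *\<^sub>v x) = cnj q" .
  have "conjugate x \<bullet> (H_theta \<theta> A *\<^sub>v x) =
     cis \<theta> / 2 * (conjugate x \<bullet> (A *\<^sub>v x)) + cis (- \<theta>) / 2 * (conjugate x \<bullet> (mat_adjoint A *\<^sub>v x))"
    unfolding form[OF H_theta_carrier[OF A]] form[OF A] form[OF mat_adjoint_carrier[OF A]]
      sum_distrib_left sum.distrib[symmetric] unfolding H_theta_pencil[OF A]
    by (intro sum.cong) (use A mat_adjoint_carrier[OF A] in \<open>auto simp: algebra_simps\<close>)
  also have "\<dots> = (cis \<theta> * q + cnj (cis \<theta> * q)) / 2"
    unfolding q' by (simp add: q_def cis_cnj add_divide_distrib)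
  also have "\<dots> = of_real (Re (cis \<theta> * q))" by (subst complex_add_cnj) simp
  finally show ?thesis unfolding q_def .
qed

text \<open>As c need not be ordered, this need not be the support function of
  \<open>W_weighted\<close>: it is an upper bound there that may fail to be attained.\<close>

definition support_bound :: "nat \<Rightarrow> complex mat \<Rightarrow> (nat \<Rightarrow> real) \<Rightarrow> real \<Rightarrow> real" where
  "support_bound n A c \<theta> = (\<Sum>j<n. c j * herm_eig (H_theta \<theta> A) ! j)"

lemma W_weighted_eq:
  "W_weighted n A c = (\<Inter>\<theta>\<in>{0..<2*pi}. {v. Re (cis \<theta> * v) \<le> support_bound n A c \<theta>})"
  unfolding W_weighted_def support_bound_def cis_conv_exp ..

lemma closed_W_weighted: "closed (W_weighted n A c)"
  unfolding W_weighted_eq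
  by (intro closed_INT ballI closed_Collect_le continuous_intros)

text \<open>The bound is the value of the identity index tuple at the eigenvalues in nonincreasing
  order.\<close>

lemma support_bound_root:
  assumes A: "A \<in> carrier_mat n n"
  shows "poly (p_poly n (H_theta \<theta> A) c) (of_real (support_bound n A c \<theta>)) = 0"
proof -
  note H = H_theta_carrier[OF A, of \<theta>]
  note he = herm_eig_Hermitian(1,2)[OF H H_theta_Hermitian[OF A]]
  have "p_poly n (H_theta \<theta> A) c = value_poly n c (map of_real (herm_eig (H_theta \<theta> A)))"
    unfolding p_poly_value_poly
    by (rule value_poly_cong_mset) (simp_all add: eig_list[OF H] he del: mset_map)
  moreover have "of_real (support_bound n A c \<theta>) =
     (\<Sum>s\<in>supp_c n c. of_real (c s) * map complex_of_real (herm_eig (H_theta \<theta> A)) ! id s)"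
  proof -
    have "support_bound n A c \<theta> = (\<Sum>s\<in>supp_c n c. c s * herm_eig (H_theta \<theta> A) ! s)"
      unfolding support_bound_def supp_c_def by (rule sum.mono_neutral_right) auto
    thus ?thesis using he(1) by (auto simp: supp_c_def intro!: sum.cong)
  qed
  hence "poly (value_poly n c (map of_real (herm_eig (H_theta \<theta> A)))) (of_real (support_bound n A c \<theta>)) = 0"
    unfolding value_poly_root_iff using index_tuple_id by blast
  ultimately show ?thesis by simp
qed

lemma ex_W_c_attaining_support_bound:
  assumes A: "A \<in> carrier_mat n n"
  obtains z where "z \<in> W_c n A c" "Re (cis \<theta> * z) = support_bound n A c \<theta>"
proof -
  obtain x :: "nat \<Rightarrow> complex vec" where x: "\<And>j. j < n \<Longrightarrow> x j \<in> carrier_vec n"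
    "\<And>j k. j < n \<Longrightarrow> k < n \<Longrightarrow> conjugate (x j) \<bullet> x k = (if j = k then 1 else 0)"
    "\<And>j. j < n \<Longrightarrow> conjugate (x j) \<bullet> (H_theta \<theta> A *\<^sub>v x j) = of_real (herm_eig (H_theta \<theta> A) ! j)"
    using herm_eig_Hermitian(3)[OF H_theta_carrier[OF A] H_theta_Hermitian[OF A], of \<theta>] by blast
  define z where "z = (\<Sum>j<n. of_real (c j) * (conjugate (x j) \<bullet> (A *\<^sub>v x j)))"
  have "z \<in> W_c n A c" unfolding W_c_def z_def using x(1,2) by blast
  moreover have "Re (cis \<theta> * z) = support_bound n A c \<theta>"
  proof -
    have "Re (cis \<theta> * (conjugate (x j) \<bullet> (A *\<^sub>v x j))) = herm_eig (H_theta \<theta> A) ! j" if "j < n" for j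
      using quadratic_form_H_theta[OF A x(1)[OF that], of \<theta>] x(3)[OF that] by (metis of_real_eq_iff)
    moreover have "cis \<theta> * z = (\<Sum>j<n. of_real (c j) * (cis \<theta> * (conjugate (x j) \<bullet> (A *\<^sub>v x j))))"
      unfolding z_def sum_distrib_left by (simp add: mult_ac)
    ultimately show ?thesis unfolding support_bound_def by simp
  qed
  ultimately show ?thesis using that by blast
qed

section \<open>Boundary points and their supporting lines\<close>

lemma tendsto_eval2:
  assumes "(X \<longlongrightarrow> x) F" "(Y \<longlongrightarrow> y) F"
  shows "((\<lambda>k. eval2 (X k) (Y k) q) \<longlongrightarrow> eval2 x y q) F"
proof (induction q)
  case 0
  thus ?case by simp
next
  case (pCons a q)
  have *: "eval2 x y (pCons a q) = poly a x + y * eval2 x y q" for x y by (simp add: eval2_def)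
  show ?case unfolding * by (intro tendsto_intros pCons.IH assms tendsto_poly)
qed

text \<open>The listed eigenvalues need not vary continuously, but the coefficients of
  \<open>p_poly\<close> along the pencil do, being values of the fixed coefficients of
  \<open>r_poly\<close>.\<close>

lemma tendsto_p_poly_pencil:
  assumes A: "A \<in> carrier_mat n n" and "(X \<longlongrightarrow> x) F" "(Y \<longlongrightarrow> y) F" "(T \<longlongrightarrow> t) F"
  shows "((\<lambda>k. poly (p_poly n (pencil A (X k) (Y k)) c) (T k)) \<longlongrightarrow> poly (p_poly n (pencil A x y) c) t) F"
proof -
  have *: "poly (p_poly n (pencil A x y) c) t = (\<Sum>l\<le>deg_c n c. eval2 x y (coeff (r_poly n A c) l) * t ^ l)" for x y t
    unfolding poly_altdef p_poly_monic by (simp flip: map_poly_r_poly[OF A])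
  show ?thesis unfolding * by (intro tendsto_intros tendsto_eval2 assms)
qed

text \<open>At a boundary point the bound is attained in the limit along some directions; compactness of
  the circle yields a supporting line there, and its offset is a root because roots of the pencil
  polynomial are preserved by limits.\<close>
lemma frontier_W_weighted_supporting:
  assumes A: "A \<in> carrier_mat n n" and z: "z \<in> frontier (W_weighted n A c)"
  obtains \<theta> where "\<And>v. v \<in> W_weighted n A c \<Longrightarrow> Re (cis \<theta> * v) \<le> Re (cis \<theta> * z)"
    "poly (p_poly n (H_theta \<theta> A) c) (of_real (Re (cis \<theta> * z))) = 0"
proof -
  let ?W = "W_weighted n A c" and ?h = "support_bound n A c"
  have zW: "z \<in> ?W" using z closed_W_weighted frontier_subset_closed by blast
  have "\<exists>\<theta>\<in>{0..<2*pi}. ?h \<theta> < Re (cis \<theta> * z) + 1 / real (Suc k)" for k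
  proof (rule ccontr)
    assume "\<not> ?thesis"
    \<comment> \<open>A uniform gap leaves room for a ball around z inside the range, because Re
      (cis \<theta> (v - z)) is at most the modulus of v - z.\<close>
    hence gap: "Re (cis \<theta> * z) + 1 / real (Suc k) \<le> ?h \<theta>" if "\<theta> \<in> {0..<2*pi}" for \<theta>
      using that by force
    have "ball z (1 / real (Suc k)) \<subseteq> ?W"
    proof
      fix v assume "v \<in> ball z (1 / real (Suc k))"
      hence v: "cmod (v - z) < 1 / real (Suc k)" by (simp add: dist_norm norm_minus_commute)
      have "Re (cis \<theta> * v) \<le> ?h \<theta>" if "\<theta> \<in> {0..<2*pi}" for \<theta>
      proof -
        have "Re (cis \<theta> * (v - z)) \<le> cmod (cis \<theta> * (v - z))" by (rule complex_Re_le_cmod)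
        also have "\<dots> = cmod (v - z)" by (simp add: norm_mult)
        finally have "Re (cis \<theta> * v) - Re (cis \<theta> * z) \<le> cmod (v - z)" by (simp add: right_diff_distrib)
        thus ?thesis using gap[OF that] v by linarith
      qed
      thus "v \<in> ?W" unfolding W_weighted_eq by auto
    qed
    hence "z \<in> interior ?W" by (intro interiorI[of "ball z (1 / real (Suc k))"]) auto
    thus False using z by (simp add: frontier_def)
  qed
  then obtain \<phi> where \<phi>: "\<And>k. \<phi> k \<in> {0..<2*pi}" "\<And>k. ?h (\<phi> k) < Re (cis (\<phi> k) * z) + 1 / real (Suc k)"
    by metis
  \<comment> \<open>The closed interval is taken for compactness. The limit may be 2 pi, which the
    conclusion admits.\<close>
  have "\<forall>k. \<phi> k \<in> {0..2*pi}" using \<phi>(1) by (meson atLeastAtMost_iff atLeastLessThan_iff less_imp_le)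
  then obtain \<theta> r where r: "strict_mono r" "(\<phi> \<circ> r) \<longlonglongrightarrow> \<theta>"
    using compact_imp_seq_compact[OF compact_Icc] seq_compactE by metis
  have cis: "(\<lambda>k. cis (\<phi> (r k))) \<longlonglongrightarrow> cis \<theta>" "(\<lambda>k. cis (- \<phi> (r k))) \<longlonglongrightarrow> cis (- \<theta>)"
    using r(2) unfolding comp_def by (auto intro!: tendsto_intros)
  have re: "(\<lambda>k. Re (cis (\<phi> (r k)) * v)) \<longlonglongrightarrow> Re (cis \<theta> * v)" for v
    by (intro tendsto_intros cis)
  have "(\<lambda>k. 1 / real (Suc (r k))) \<longlonglongrightarrow> 0"
    using LIMSEQ_subseq_LIMSEQ[OF LIMSEQ_inverse_real_of_nat r(1)] by (simp add: comp_def inverse_eq_divide)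
  hence up: "(\<lambda>k. Re (cis (\<phi> (r k)) * z) + 1 / real (Suc (r k))) \<longlonglongrightarrow> Re (cis \<theta> * z)"
    using tendsto_add[OF re[of z]] by fastforce
  have h: "(\<lambda>k. ?h (\<phi> (r k))) \<longlonglongrightarrow> Re (cis \<theta> * z)"
  proof (rule tendsto_sandwich[OF _ _ re[of z] up])
    show "\<forall>\<^sub>F k in sequentially. Re (cis (\<phi> (r k)) * z) \<le> ?h (\<phi> (r k))"
      using zW \<phi>(1) unfolding W_weighted_eq by (intro always_eventually) auto
    show "\<forall>\<^sub>F k in sequentially. ?h (\<phi> (r k)) \<le> Re (cis (\<phi> (r k)) * z) + 1 / real (Suc (r k))"
      using \<phi>(2) by (intro always_eventually) (auto intro: less_imp_le)
  qed
  have 1: "Re (cis \<theta> * v) \<le> Re (cis \<theta> * z)" if "v \<in> ?W" for v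
  proof (rule LIMSEQ_le[OF re[of v] h])
    show "\<exists>N. \<forall>k\<ge>N. Re (cis (\<phi> (r k)) * v) \<le> ?h (\<phi> (r k))"
      using that \<phi>(1) unfolding W_weighted_eq by auto
  qed
  have "(\<lambda>k. poly (p_poly n (H_theta (\<phi> (r k)) A) c) (of_real (?h (\<phi> (r k))))) \<longlonglongrightarrow>
      poly (p_poly n (H_theta \<theta> A) c) (of_real (Re (cis \<theta> * z)))"
    unfolding H_theta_pencil[OF A]
    by (intro tendsto_p_poly_pencil[OF A] tendsto_divide tendsto_const tendsto_of_real cis h) auto
  hence 2: "poly (p_poly n (H_theta \<theta> A) c) (of_real (Re (cis \<theta> * z))) = 0"
    by (simp add: support_bound_root[OF A] LIMSEQ_const_iff)
  show ?thesis using that 1 2 by blast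
qed

text \<open>A functional that is maximal on S at z has a local maximum at 0 along the graph, so its
  derivative there, which is its value on the tangent u (1 + i D), vanishes.\<close>

lemma differentiable_boundary_tangent:
  assumes "closed S" "boundary_differentiable_at S z"
  obtains \<tau> where "\<tau> \<noteq> 0" "\<And>w. (\<And>v. v \<in> S \<Longrightarrow> Re (w * v) \<le> Re (w * z)) \<Longrightarrow> Re (w * \<tau>) = 0"
proof -
  obtain u f e where u: "cmod u = 1" and e: "e > 0" and f: "f 0 = (0::real)" "f differentiable (at 0)"
    and gr: "frontier S \<inter> ball z e = range (\<lambda>s. z + u * Complex s (f s)) \<inter> ball z e"
    using assms(2) unfolding boundary_differentiable_at_def by blast
  obtain D where D: "(f has_real_derivative D) (at 0)"
    using f(2) by (auto simp: real_differentiable_def)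
  have "isCont f 0" using D by (rule DERIV_isCont)
  \<comment> \<open>The function f is known to be continuous only at 0; this already keeps the graph
    inside the ball for small parameters.\<close>
  hence "isCont (\<lambda>s. cmod (Complex s (f s))) 0"
    unfolding cmod_def by (auto intro!: continuous_intros)
  hence "\<exists>\<delta>>0. \<forall>s. norm (s - 0) < \<delta> \<longrightarrow> norm (cmod (Complex s (f s)) - cmod (Complex 0 (f 0))) < e"
    using e unfolding continuous_at_eps_delta dist_norm by blast
  hence "\<exists>\<delta>>0. \<forall>s. \<bar>s\<bar> < \<delta> \<longrightarrow> cmod (Complex s (f s)) < e" using f(1) by (simp add: complex_norm)
  then obtain \<delta> where \<delta>: "\<delta> > 0" "\<And>s. \<bar>s\<bar> < \<delta> \<Longrightarrow> cmod (Complex s (f s)) < e" by blast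
  have inS: "z + u * Complex s (f s) \<in> S" if "\<bar>s\<bar> < \<delta>" for s
  proof -
    have "z + u * Complex s (f s) \<in> ball z e" using \<delta>(2)[OF that] u by (simp add: dist_norm norm_mult)
    hence "z + u * Complex s (f s) \<in> frontier S" using gr by blast
    thus ?thesis using assms(1) frontier_subset_closed by blast
  qed
  have "Re (w * (u * Complex 1 D)) = 0" if w: "\<And>v. v \<in> S \<Longrightarrow> Re (w * v) \<le> Re (w * z)" for w
  proof -
    define g where "g s = Re (w * u) * s - Im (w * u) * f s" for s
    have g: "g s = Re (w * (u * Complex s (f s)))" for s
      unfolding g_def by (simp add: mult.assoc[symmetric])
    have "(g has_real_derivative (Re (w * u) - Im (w * u) * D)) (at 0)"
      unfolding g_def by (auto intro!: derivative_eq_intros D)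
    moreover have "g s \<le> g 0" if "\<bar>0 - s\<bar> < \<delta>" for s
    proof -
      have "Re (w * (z + u * Complex s (f s))) \<le> Re (w * z)" by (rule w[OF inS]) (use that in simp)
      hence "g s \<le> 0" unfolding g by (simp add: distrib_left)
      thus ?thesis using f(1) by (simp add: g_def)
    qed
    ultimately have "Re (w * u) - Im (w * u) * D = 0" using DERIV_local_max[of g _ 0 \<delta>] \<delta>(1) by blast
    thus ?thesis by (simp add: mult.assoc[symmetric])
  qed
  moreover have "u \<noteq> 0" using u by auto
  hence "u * Complex 1 D \<noteq> 0" by (simp add: complex_eq_iff[of "Complex 1 D"])
  ultimately show ?thesis using that by blast
qed

text \<open>If the range is \<open>W_c\<close>, an attaining point and the contact point squeeze a
  to the bound. Otherwise the tangent fixes the supporting direction up to sign, and the interior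
  point excludes the opposite sign.\<close>

lemma supporting_line_root:
  assumes A: "A \<in> carrier_mat n n" and \<theta>: "\<theta> \<in> {0..<2*pi}"
    and supp: "\<And>v. v \<in> W_weighted n A c \<Longrightarrow> Re (cis \<theta> * v) \<le> a"
    and meets: "\<exists>v\<in>W_weighted n A c. Re (cis \<theta> * v) = a"
    and reg: "W_weighted n A c = W_c n A c \<or> interior (W_weighted n A c) \<noteq> {} \<and>
      (\<exists>z. Re (cis \<theta> * z) = a \<and> boundary_differentiable_at (W_weighted n A c) z)"
  shows "poly (p_poly n (H_theta \<theta> A) c) (of_real a) = 0"
  using reg
proof
  assume eq: "W_weighted n A c = W_c n A c"
  obtain z where z: "z \<in> W_c n A c" "Re (cis \<theta> * z) = support_bound n A c \<theta>"
    using ex_W_c_attaining_support_bound[OF A] by blast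
  have "support_bound n A c \<theta> \<le> a" using supp z eq by force
  moreover have "a \<le> support_bound n A c \<theta>" using meets \<theta> unfolding W_weighted_eq by auto
  ultimately show ?thesis using support_bound_root[OF A, of \<theta> c] by simp
next
  let ?W = "W_weighted n A c"
  assume "interior ?W \<noteq> {} \<and> (\<exists>z. Re (cis \<theta> * z) = a \<and> boundary_differentiable_at ?W z)"
  then obtain p z where p: "p \<in> interior ?W" and z: "Re (cis \<theta> * z) = a" "boundary_differentiable_at ?W z"
    by blast
  have "z \<in> frontier ?W" using z(2) by (simp add: boundary_differentiable_at_def)
  then obtain \<phi> where \<phi>: "\<And>v. v \<in> ?W \<Longrightarrow> Re (cis \<phi> * v) \<le> Re (cis \<phi> * z)"
    "poly (p_poly n (H_theta \<phi> A) c) (of_real (Re (cis \<phi> * z))) = 0"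
    using frontier_W_weighted_supporting[OF A] by blast
  obtain \<tau> where \<tau>: "\<tau> \<noteq> 0" "\<And>w. (\<And>v. v \<in> ?W \<Longrightarrow> Re (w * v) \<le> Re (w * z)) \<Longrightarrow> Re (w * \<tau>) = 0"
    using differentiable_boundary_tangent[OF closed_W_weighted z(2)] by blast
  have "Re (cis \<theta> * \<tau>) = 0" using \<tau>(2)[of "cis \<theta>"] supp unfolding z(1)[symmetric] by blast
  moreover have "Re (cis \<phi> * \<tau>) = 0" using \<tau>(2)[of "cis \<phi>"] \<phi>(1) by blast
  ultimately have re0: "Re (cis \<theta> * \<tau>) = 0" "Re (cis \<phi> * \<tau>) = 0" by auto
  \<comment> \<open>Both products are purely imaginary with the modulus of \<tau>, hence equal up to
    sign.\<close>
  have "\<bar>Im (cis \<theta> * \<tau>)\<bar> = \<bar>Im (cis \<phi> * \<tau>)\<bar>"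
  proof -
    have "\<bar>Im w\<bar> = cmod w" if "Re w = 0" for w using that by (simp add: cmod_def)
    from this[OF re0(1)] this[OF re0(2)] show ?thesis by (simp only: norm_mult norm_cis)
  qed
  hence "cis \<phi> * \<tau> = cis \<theta> * \<tau> \<or> cis \<phi> * \<tau> = - (cis \<theta> * \<tau>)"
    using re0 by (auto simp: complex_eq_iff abs_eq_iff simp del: times_complex.sel)
  hence "cis \<phi> = cis \<theta> \<or> cis \<phi> = - cis \<theta>" using \<tau>(1) by (metis mult_cancel_right mult_minus_left)
  moreover have "cis \<phi> \<noteq> - cis \<theta>"
  proof
    assume opp: "cis \<phi> = - cis \<theta>"
    \<comment> \<open>Supporting lines through z with opposite directions press the whole range into
      a single line.\<close>
    have line: "Re (cis \<theta> * v) = a" if "v \<in> ?W" for v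
      using \<phi>(1)[OF that] supp[OF that] z(1) unfolding opp by simp
    obtain e where e: "e > 0" "ball p e \<subseteq> ?W" using p by (meson mem_interior)
    \<comment> \<open>A step of length e / 2 along cis (- \<theta>) raises the functional by e / 2,
      so p and its translate cannot both lie on that line.\<close>
    have "p \<in> ?W" "p + of_real (e / 2) * cis (- \<theta>) \<in> ?W"
      using e by (auto simp: dist_norm norm_mult subset_iff)
    hence "Re (cis \<theta> * p) = a" "Re (cis \<theta> * (p + of_real (e / 2) * cis (- \<theta>))) = a" using line by blast+
    moreover have "cis \<theta> * (p + of_real (e / 2) * cis (- \<theta>)) = cis \<theta> * p + of_real (e / 2)"
    proof -
      have "cis \<theta> * cis (- \<theta>) = 1" by (simp add: cis_mult)
      hence "cis \<theta> * (of_real (e / 2) * cis (- \<theta>)) = of_real (e / 2)" by (metis mult.left_commute mult.right_neutral)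
      thus ?thesis by (simp add: distrib_left)
    qed
    ultimately have "a = a + e / 2" by (metis Re_complex_of_real plus_complex.sel(1))
    thus False using e(1) by simp
  qed
  ultimately have eq: "cis \<phi> = cis \<theta>" by blast
  hence "cis (- \<phi>) = cis (- \<theta>)" by (metis cis_cnj)
  hence "H_theta \<phi> A = H_theta \<theta> A" unfolding H_theta_pencil[OF A] using eq by simp
  thus ?thesis using \<phi>(2) unfolding eq z(1) by simp
qed

section \<open>Intersection of the two curves\<close>

abbreviation dehomogenize :: "complex poly poly poly \<Rightarrow> complex poly poly" where
  "dehomogenize \<equiv> map_poly (\<lambda>p. poly p [:1:])"

lemma dehomogenize_r_poly:
  assumes A: "A \<in> carrier_mat n n"
  shows "degree (dehomogenize (r_poly n A c)) = deg_c n c"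
    and "lead_coeff (dehomogenize (r_poly n A c)) = 1"
    and "poly (poly (dehomogenize (r_poly n A c)) [:t:]) x = poly (p_poly n (pencil A x 1) c) t"
proof -
  let ?r = "r_poly n A c"
  have co: "coeff (dehomogenize ?r) i = poly (coeff ?r i) [:1:]" for i by (simp add: coeff_map_poly)
  have 1: "coeff (dehomogenize ?r) (deg_c n c) = 1" unfolding co r_poly_monic(2)[OF A] by simp
  moreover have "degree (dehomogenize ?r) \<le> deg_c n c"
    using degree_map_poly_le[of "\<lambda>p. poly p [:1:]" ?r] r_poly_monic(1)[OF A, of c] by simp
  ultimately show deg: "degree (dehomogenize ?r) = deg_c n c"
    using le_degree[of "dehomogenize ?r" "deg_c n c"] by simp
  show "lead_coeff (dehomogenize ?r) = 1" using 1 deg by simp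
  have "map_poly (\<lambda>p. poly p x) (dehomogenize ?r) = map_poly (eval2 x 1) ?r"
    by (subst map_poly_map_poly) (auto simp: eval2_def intro!: map_poly_cong)
  thus "poly (poly (dehomogenize ?r) [:t:]) x = poly (p_poly n (pencil A x 1) c) t"
    unfolding poly_poly_const by (simp add: map_poly_r_poly[OF A])
qed

lemma coeff_p_poly_pencil_scale:
  assumes A: "A \<in> carrier_mat n n" and s: "s \<noteq> 0" and i: "i \<le> deg_c n c"
  shows "coeff (p_poly n (pencil A (s * x) (s * y)) c) i = s ^ (deg_c n c - i) * coeff (p_poly n (pencil A x y) c) i"
proof -
  \<comment> \<open>Substituting s t for t turns the scaling of values into an identity of
    polynomials in t, whose coefficients can be compared.\<close>
  have "pcompose (p_poly n (pencil A (s * x) (s * y)) c) [:0, s:] =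
      Polynomial.smult (s ^ deg_c n c) (p_poly n (pencil A x y) c)"
    using p_poly_pencil_scale[OF A s, of x y c]
    by (simp add: poly_eq_poly_eq_iff[symmetric] fun_eq_iff poly_pcompose mult.commute)
  from arg_cong[OF this, of "\<lambda>p. coeff p i"]
  have "s ^ i * coeff (p_poly n (pencil A (s * x) (s * y)) c) i = s ^ deg_c n c * coeff (p_poly n (pencil A x y) c) i"
    by (simp add: coeff_pcompose_linear mult.commute)
  also have "s ^ deg_c n c = s ^ i * s ^ (deg_c n c - i)" using i by (simp flip: power_add)
  finally show ?thesis using s by simp
qed

text \<open>The coefficient of \<open>t\<^sup>i\<close> is homogeneous of degree \<open>k = deg - i\<close>, so that
  \<open>a(x, 1) = x\<^sup>k a(1, 1/x)\<close> grows at most like \<open>x\<^sup>k\<close>.\<close>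
lemma degree_coeff_dehomogenize_r_poly:
  assumes A: "A \<in> carrier_mat n n" and nz: "coeff (dehomogenize (r_poly n A c)) i \<noteq> 0"
  shows "degree (coeff (dehomogenize (r_poly n A c)) i) + i \<le> deg_c n c"
proof -
  define q where "q = coeff (r_poly n A c) i"
  define a where "a = coeff (dehomogenize (r_poly n A c)) i"
  define b where "b = map_poly (\<lambda>p. poly p 1) q"
  have i: "i \<le> deg_c n c" using nz dehomogenize_r_poly(1)[OF A, of c] le_degree by metis
  define k where "k = deg_c n c - i"
  have ev: "eval2 x y q = coeff (p_poly n (pencil A x y) c) i" for x y
    unfolding q_def map_poly_r_poly[OF A, symmetric] by simp
  have a: "poly a x = eval2 x 1 q" for x by (simp add: a_def q_def coeff_map_poly eval2_def)
  have b: "poly b y = eval2 1 y q" for y by (simp add: b_def eval2_def poly_poly_const)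
  \<comment> \<open>The factor x ^ \<open>degree b\<close> clears the denominators of b(1 / x),
    producing \<open>reflect_poly b\<close>. It cancels again in the degree count.\<close>
  have "poly (monom 1 (degree b) * a) x = poly (monom 1 k * reflect_poly b) x" if x: "x \<noteq> 0" for x
  proof -
    have "poly a x = x ^ k * poly b (1 / x)"
      unfolding a b ev k_def using coeff_p_poly_pencil_scale[OF A x i, of 1 "1 / x"] x by simp
    moreover have "poly (reflect_poly b) x = x ^ degree b * poly b (1 / x)"
      using x by (simp add: poly_reflect_poly_nz inverse_eq_divide)
    ultimately show ?thesis by (simp add: poly_monom)
  qed
  hence "monom 1 (degree b) * a - monom 1 k * reflect_poly b = 0"
    by (intro poly_eq_0_infinite[of "- {0}"])
       (auto simp: infinite_UNIV_char_0 finite_compl)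
  hence eq: "monom 1 (degree b) * a = monom 1 k * reflect_poly b" by simp
  have "degree b + degree a = degree (monom 1 (degree b) * a)"
    using nz by (simp add: degree_mult_eq degree_monom_eq a_def)
  also have "\<dots> \<le> k + degree (reflect_poly b)"
    unfolding eq by (rule degree_monom_1_mult)
  also have "\<dots> \<le> k + degree b" by (simp add: degree_reflect_poly_le)
  finally show ?thesis using i by (simp add: k_def a_def)
qed

text \<open>Both polynomials are monic in t, so specialization preserves their degrees and hence the
  shape of the Sylvester matrix.\<close>

lemma eval2_resultant_r_poly:
  assumes A: "A \<in> carrier_mat n n" and B: "B \<in> carrier_mat m m"
  shows "eval2 x y (resultant (r_poly n A c) (r_poly m B d)) =
    resultant (p_poly n (pencil A x y) c) (p_poly m (pencil B x y) d)"
  using comm_ring_hom.resultant_map_poly[OF eval2.comm_ring_hom_axioms, of x y "r_poly n A c" "r_poly m B d"]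
  by (simp add: map_poly_r_poly[OF A] map_poly_r_poly[OF B] p_poly_monic r_poly_monic[OF A] r_poly_monic[OF B])

text \<open>\<open>bezout_affine\<close> gives vanishing in the chart y = 1 only. There it means a
  common root above (x / y, 1), which homogeneity carries to (x, y); so the resultant vanishes for
  all nonzero y, hence identically.\<close>

lemma resultant_r_poly_eq_0:
  assumes A: "A \<in> carrier_mat n n" and B: "B \<in> carrier_mat m m"
    and P: "finite P" "card P > deg_c n c * deg_c m d"
    and roots: "\<And>x t. (x, t) \<in> P \<Longrightarrow>
      poly (p_poly n (pencil A x 1) c) t = 0 \<and> poly (p_poly m (pencil B x 1) d) t = 0"
  shows "resultant (r_poly n A c) (r_poly m B d) = 0"
proof (rule eval2_eq_0)
  fix x y :: complex assume y: "y \<noteq> 0"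
  let ?f = "dehomogenize (r_poly n A c)" and ?g = "dehomogenize (r_poly m B d)"
  have hom: "comm_ring_hom (\<lambda>p :: complex poly poly. poly p [:1:])" by unfold_locales auto
  have "resultant ?f ?g = 0"
    by (rule bezout_affine[OF _ _ _ P(1)])
       (use P(2) roots degree_coeff_dehomogenize_r_poly[OF A] degree_coeff_dehomogenize_r_poly[OF B]
          dehomogenize_r_poly[OF A] dehomogenize_r_poly[OF B] in auto)
  moreover have "resultant ?f ?g = poly (resultant (r_poly n A c) (r_poly m B d)) [:1:]"
    by (rule comm_ring_hom.resultant_map_poly[OF hom])
       (simp_all add: dehomogenize_r_poly[OF A] dehomogenize_r_poly[OF B] r_poly_monic[OF A] r_poly_monic[OF B])
  ultimately have "eval2 (x / y) 1 (resultant (r_poly n A c) (r_poly m B d)) = 0" by (simp add: eval2_def)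
  hence "resultant (p_poly n (pencil A (x / y) 1) c) (p_poly m (pencil B (x / y) 1) d) = 0"
    by (simp add: eval2_resultant_r_poly[OF A B])
  moreover have "p_poly n M c \<noteq> 0" for n M c using p_poly_monic(2)[of n M c] by auto
  ultimately obtain t where t: "poly (p_poly n (pencil A (x / y) 1) c) t = 0" "poly (p_poly m (pencil B (x / y) 1) d) t = 0"
    using resultant_eq_0_imp_common_root by metis
  have "poly (p_poly n (pencil A x y) c) (y * t) = 0" "poly (p_poly m (pencil B x y) d) (y * t) = 0"
    using p_poly_pencil_scale[OF A y, of "x / y" 1 c t] p_poly_pencil_scale[OF B y, of "x / y" 1 d t] t y by simp_all
  thus "eval2 x y (resultant (r_poly n A c) (r_poly m B d)) = 0"
    unfolding eval2_resultant_r_poly[OF A B]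
    by (rule common_root_imp_resultant_eq_0) (simp add: p_poly_monic deg_c_pos)
qed

lemma r_poly_common_values:
  assumes A: "A \<in> carrier_mat n n" and B: "B \<in> carrier_mat m m"
    and res: "resultant (r_poly n A c) (r_poly m B d) = 0"
  shows "\<exists>v. c_value n A c v \<and> c_value m B d v"
    and "irreducible (r_poly n A c) \<Longrightarrow> c_value n A c v \<Longrightarrow> c_value m B d v"
proof -
  have p10: "pencil M 1 0 = M" if "M \<in> carrier_mat k k" for M k
    by (rule eq_matI) (use that mat_adjoint_carrier[OF that] in auto)
  have "resultant (p_poly n A c) (p_poly m B d) = 0"
    using eval2_resultant_r_poly[OF A B, of 1 0 c d] res by (simp add: p10[OF A] p10[OF B])
  moreover have "p_poly n M c \<noteq> 0" for n M c using p_poly_monic(2)[of n M c] by auto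
  ultimately show "\<exists>v. c_value n A c v \<and> c_value m B d v"
    unfolding c_value_iff_root using resultant_eq_0_imp_common_root by metis
  assume "irreducible (r_poly n A c)" and v: "c_value n A c v"
  hence "r_poly n A c dvd r_poly m B d"
    using resultant_eq_0_imp_dvd[OF res] irreducible_imp_prime_elem by blast
  then obtain h where "r_poly m B d = r_poly n A c * h" by (elim dvdE)
  \<comment> \<open>At (1, 0) the pencil is the matrix itself, so divisibility passes the root v of
    p(A;c) on to p(B;d).\<close>
  hence "eval3 (r_poly m B d) 1 0 v = eval3 (r_poly n A c) 1 0 v * eval3 h 1 0 v"
    by (simp add: eval3_def)
  thus "c_value m B d v" using v
    unfolding c_value_iff_root eval3_eq map_poly_r_poly[OF A] map_poly_r_poly[OF B] p10[OF A] p10[OF B]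
    by simp
qed

section \<open>From common supporting lines to common zeros\<close>

lemma cis_square_eq_imp:
  assumes "cis (2 * \<theta>) = cis (2 * \<phi>)"
  shows "cis \<theta> = cis \<phi> \<or> cis \<theta> = - cis \<phi>"
proof -
  have "(cis \<theta>)\<^sup>2 = (cis \<phi>)\<^sup>2" using assms by (simp add: Complex.DeMoivre)
  thus ?thesis by (simp add: power2_eq_iff)
qed

theorem mainTheorem10:
  fixes A B :: "complex mat" and n m :: nat and c d :: "nat \<Rightarrow> real"
  assumes "A \<in> carrier_mat n n" and "B \<in> carrier_mat m m"
    and "W_weighted n A c \<noteq> {}" and "W_weighted m B d \<noteq> {}"
    and "\<exists>Ls. finite Ls \<and> card Ls > deg_c n c * deg_c m d \<and>
           (\<forall>L\<in>Ls. common_supporting_line (W_weighted n A c) (W_weighted m B d) L) \<and>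
           (W_weighted n A c = W_c n A c \<or>
              (interior (W_weighted n A c) \<noteq> {} \<and>
               (\<forall>L\<in>Ls. \<exists>z\<in>L. boundary_differentiable_at (W_weighted n A c) z))) \<and>
           (W_weighted m B d = W_c m B d \<or>
              (interior (W_weighted m B d) \<noteq> {} \<and>
               (\<forall>L\<in>Ls. \<exists>z\<in>L. boundary_differentiable_at (W_weighted m B d) z)))"
  shows "(\<exists>v. c_value n A c v \<and> c_value m B d v) \<and>
         (irreducible (r_poly n A c) \<longrightarrow> (\<forall>v. c_value n A c v \<longrightarrow> c_value m B d v))"
proof -
  note A = assms(1) and B = assms(2)
  let ?WA = "W_weighted n A c" and ?WB = "W_weighted m B d"
  obtain Ls where Ls: "finite Ls" "card Ls > deg_c n c * deg_c m d"
    and csl: "\<And>L. L \<in> Ls \<Longrightarrow> common_supporting_line ?WA ?WB L"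
    and regA: "?WA = W_c n A c \<or> interior ?WA \<noteq> {} \<and> (\<forall>L\<in>Ls. \<exists>z\<in>L. boundary_differentiable_at ?WA z)"
    and regB: "?WB = W_c m B d \<or> interior ?WB \<noteq> {} \<and> (\<forall>L\<in>Ls. \<exists>z\<in>L. boundary_differentiable_at ?WB z)"
    using assms(5) by blast
  have "\<exists>\<theta> a. L = {z. Re (cis \<theta> * z) = a} \<and> poly (p_poly n (H_theta \<theta> A) c) (of_real a) = 0 \<and>
      poly (p_poly m (H_theta \<theta> B) d) (of_real a) = 0" if L: "L \<in> Ls" for L
  proof -
    obtain u a where u: "u \<noteq> 0" "L = {z. Re (cnj u * z) = a}"
      and sub: "?WA \<subseteq> {z. Re (cnj u * z) \<le> a}" "?WB \<subseteq> {z. Re (cnj u * z) \<le> a}"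
      and meet: "L \<inter> ?WA \<noteq> {}" "L \<inter> ?WB \<noteq> {}"
      using csl[OF L] unfolding common_supporting_line_def by blast
    \<comment> \<open>The normal vector \<open>cnj u\<close> is scaled to the unit circle, as in the
      definition of the weighted range, and the offset a becomes a / r.\<close>
    define \<theta> where "\<theta> = Arg2pi (cnj u)"
    have \<theta>: "\<theta> \<in> {0..<2*pi}" unfolding \<theta>_def using Arg2pi_ge_0 Arg2pi_lt_2pi by auto
    define r where "r = cmod u"
    have r: "r > 0" using u(1) by (simp add: r_def)
    have "cnj u = of_real r * cis \<theta>"
      using Arg2pi_eq[of "cnj u"] by (simp add: \<theta>_def r_def cis_conv_exp)
    hence re: "Re (cnj u * z) = r * Re (cis \<theta> * z)" for z
      by (simp add: algebra_simps)
    have "r * b = a \<longleftrightarrow> b = a / r" for b using r by (auto simp: field_simps)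
    hence L_eq: "L = {z. Re (cis \<theta> * z) = a / r}" unfolding u(2) re by blast
    have "Re (cis \<theta> * v) \<le> a / r" if "v \<in> ?WA \<union> ?WB" for v
    proof -
      have "r * Re (cis \<theta> * v) \<le> a" using that sub unfolding re by blast
      thus ?thesis using r by (simp only: pos_le_divide_eq mult.commute)
    qed
    hence le: "\<And>v. v \<in> ?WA \<Longrightarrow> Re (cis \<theta> * v) \<le> a / r" "\<And>v. v \<in> ?WB \<Longrightarrow> Re (cis \<theta> * v) \<le> a / r" by blast+
    have on: "\<exists>v\<in>?WA. Re (cis \<theta> * v) = a / r" "\<exists>v\<in>?WB. Re (cis \<theta> * v) = a / r"
      using meet unfolding L_eq by blast+
    have touch: "\<exists>z. Re (cis \<theta> * z) = a / r \<and> Q z" if "\<forall>L\<in>Ls. \<exists>z\<in>L. Q z" for Q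
      using bspec[OF that L] unfolding L_eq by blast
    have "poly (p_poly n (H_theta \<theta> A) c) (of_real (a / r)) = 0"
      using regA touch[of "boundary_differentiable_at ?WA"]
      by (intro supporting_line_root[OF A \<theta> le(1) on(1)]) argo+
    moreover have "poly (p_poly m (H_theta \<theta> B) d) (of_real (a / r)) = 0"
      using regB touch[of "boundary_differentiable_at ?WB"]
      by (intro supporting_line_root[OF B \<theta> le(2) on(2)]) argo+
    ultimately show ?thesis using L_eq by blast
  qed
  then obtain \<theta> a where line: "\<And>L. L \<in> Ls \<Longrightarrow> L = {z. Re (cis (\<theta> L) * z) = a L}"
    and rootA: "\<And>L. L \<in> Ls \<Longrightarrow> poly (p_poly n (H_theta (\<theta> L) A) c) (of_real (a L)) = 0"
    and rootB: "\<And>L. L \<in> Ls \<Longrightarrow> poly (p_poly m (H_theta (\<theta> L) B) d) (of_real (a L)) = 0"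
    by metis
  \<comment> \<open>The zero (cis \<theta> / 2, cis (- \<theta>) / 2, a) is multiplied by 2 cis
    \<theta>, which makes the middle coordinate 1.\<close>
  define pt where "pt L = (cis (2 * \<theta> L), 2 * cis (\<theta> L) * of_real (a L))" for L
  have "inj_on pt Ls"
  proof (rule inj_onI)
    fix L L' assume L: "L \<in> Ls" "L' \<in> Ls" and eq: "pt L = pt L'"
    have "cis (\<theta> L) = cis (\<theta> L') \<or> cis (\<theta> L) = - cis (\<theta> L')"
      using eq by (intro cis_square_eq_imp) (simp add: pt_def)
    moreover have t: "cis (\<theta> L) * of_real (a L) = cis (\<theta> L') * of_real (a L')" using eq by (simp add: pt_def)
    ultimately consider "cis (\<theta> L) = cis (\<theta> L')" "a L = a L'" | "cis (\<theta> L) = - cis (\<theta> L')" "a L = - a L'"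
    proof (elim disjE)
      assume 1: "cis (\<theta> L) = - cis (\<theta> L')"
      hence "cis (\<theta> L') * of_real (- a L) = cis (\<theta> L') * of_real (a L')" using t by simp
      hence "- a L = a L'" by (metis cis_neq_zero mult_cancel_left of_real_eq_iff)
      thus ?thesis using that(2) 1 by simp
    qed (use that(1) t in simp)
    thus "L = L'"
    proof cases
      case 1
      thus ?thesis using line[OF L(1)] line[OF L(2)] by simp
    next
      case 2
      \<comment> \<open>The point \<open>pt L\<close> forgets the orientation of the normal vector,
        but reversing it together with the sign of the offset describes the same line.\<close>
      have "Re (cis (\<theta> L) * z) = a L \<longleftrightarrow> Re (cis (\<theta> L') * z) = a L'" for z
        unfolding 2 by (simp only: mult_minus_left uminus_complex.sel neg_equal_iff_equal)
      thus ?thesis using line[OF L(1)] line[OF L(2)] by blast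
    qed
  qed
  hence "card (pt ` Ls) > deg_c n c * deg_c m d" using Ls(2) by (simp add: card_image)
  moreover have scale: "poly (p_poly k (pencil M (cis (2 * \<phi>)) 1) e) (2 * cis \<phi> * of_real b) = 0"
    if M: "M \<in> carrier_mat k k" and "poly (p_poly k (H_theta \<phi> M) e) (of_real b) = 0" for M k e \<phi> b
  proof -
    have "cis (2 * \<phi>) = 2 * cis \<phi> * (cis \<phi> / 2)" "1 = 2 * cis \<phi> * (cis (- \<phi>) / 2)" by (simp_all add: cis_mult)
    thus ?thesis
      using p_poly_pencil_scale[OF M, of "2 * cis \<phi>" "cis \<phi> / 2" "cis (- \<phi>) / 2" e "of_real b"] that(2)
      unfolding H_theta_pencil[OF M] by simp
  qed
  ultimately have "resultant (r_poly n A c) (r_poly m B d) = 0"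
    using Ls(1) by (intro resultant_r_poly_eq_0[OF A B, of "pt ` Ls"])
      (auto simp: pt_def intro!: scale[OF A] scale[OF B] rootA rootB)
  thus ?thesis using r_poly_common_values[OF A B] by blast
qed

end
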